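(* Let $\mathfrak{g}=\mathfrak{g}_L\ltimes\mathfrak{h}$ be a perfect Lie algebra with simple Levi subalgebra $\mathfrak{g}_L$ and $\mathfrak{h}=\mathrm{Rad}(\mathfrak{g})$. Suppose that $\mathfrak{h}=V_n\oplus V_m\oplus V_p\oplus V_k$ as a direct sum of simple $\mathfrak{g}_L$-modules, that $Z(\mathfrak{h})=V_k$, and that whenever two summands $V,W$ (possibly equal) satisfy $[V,W]\neq0$, there is a unique summand $U$ with $[V,W]=U$. Then, up to relabelling the summands $V_n,V_m,V_p$, the algebra structure of $\mathfrak{h}$ is given by one of the following (brackets of pairs of summands not listed in (2) and (3) are zero): (1) $[\mathfrak{h},\mathfrak{h}]=Z(\mathfrak{h})$; or (2) $[\mathfrak{h},\mathfrak{h}]=V_m\oplus V_p\oplus V_k$ and $[V_n,V_n]=V_m$, $[V_n,V_m]=V_p$, $[V_n,V_p]=V_k$, $[V_m,V_m]\in\{V_k,0\}$; or (3) $[\mathfrak{h},\mathfrak{h}]=V_p\oplus V_k$ and one of the following holds: (3a) $[V_n,V_n]\in\{V_p,V_k,0\}$, $[V_n,V_m]=V_p$, $[V_m,V_m]\in\{V_p,V_k,0\}$, $[V_n,V_p]=V_k$, $[V_m,V_p]=V_k$; (3b) $[V_n,V_n]\in\{V_p,V_k,0\}$, $[V_n,V_m]=V_p$, $[V_m,V_m]\in\{V_k,0\}$, $[V_n,V_p]=V_k$; (3c) $[V_n,V_n]=V_p$, $[V_m,V_m]=V_k$, $[V_n,V_p]=V_k$; (3d) $[V_n,V_n]=V_p$,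 $[V_n,V_m]=V_k$, $[V_m,V_m]\in\{V_k,0\}$, $[V_n,V_p]=V_k$.
   Context: All Lie algebras and vector spaces are finite dimensional over $\mathbb{C}$. $\mathfrak{g}$ is perfect if $\mathfrak{g}=[\mathfrak{g},\mathfrak{g}]$; then $\mathrm{Rad}(\mathfrak{g})$ is nilpotent. $\mathfrak{g}=\mathfrak{g}_L\ltimes\mathfrak{h}$ is a Levi decomposition, and $\mathfrak{h}$ is a $\mathfrak{g}_L$-module via the Lie bracket. $V_n,V_m,V_p,V_k$ are simple submodules of $\mathfrak{h}$ (subscripts are highest weights; distinct summands may be isomorphic). $[A,B]$ denotes the linear span of all brackets $[a,b]$, $a\in A$, $b\in B$. *)

theory Defs
  imports Complex_Main "HOL-Library.FuncSet" "HOL-Library.Multiset"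
begin

class complex_vector = ab_group_add +
  fixes scaleC :: "complex \<Rightarrow> 'a \<Rightarrow> 'a"  (infixr "*\<^sub>C" 75)
  assumes scaleC_add_right: "a *\<^sub>C (x + y) = a *\<^sub>C x + a *\<^sub>C y"
    and scaleC_add_left: "(a + b) *\<^sub>C x = a *\<^sub>C x + b *\<^sub>C x"
    and scaleC_scaleC: "a *\<^sub>C b *\<^sub>C x = (a * b) *\<^sub>C x"
    and scaleC_one: "1 *\<^sub>C x = x"

global_interpretation cvec: vector_space "scaleC :: complex \<Rightarrow> 'a \<Rightarrow> 'a::complex_vector"
  by unfold_locales
    (rule scaleC_add_right scaleC_add_left scaleC_scaleC scaleC_one)+

class complex_lie_algebra = complex_vector +
  fixes lie :: "'a \<Rightarrow> 'a \<Rightarrow> 'a"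
  assumes finite_dim: "\<exists>B. finite B \<and> (\<forall>x. \<exists>c. x = (\<Sum>b\<in>B. c b *\<^sub>C b))"
    and lie_add_left: "lie (x + y) z = lie x z + lie y z"
    and lie_add_right: "lie x (y + z) = lie x y + lie x z"
    and lie_scaleC_left: "lie (a *\<^sub>C x) y = a *\<^sub>C lie x y"
    and lie_scaleC_right: "lie x (a *\<^sub>C y) = a *\<^sub>C lie x y"
    and lie_self: "lie x x = 0"
    and jacobi: "lie x (lie y z) + lie y (lie z x) + lie z (lie x y) = 0"

definition brackets :: "'g::complex_lie_algebra set \<Rightarrow> 'g set \<Rightarrow> 'g set" where
  "brackets A B = cvec.span {lie a b | a b. a \<in> A \<and> b \<in> B}"

definition perfect_lie :: "'g::complex_lie_algebra set \<Rightarrow> bool" where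
  "perfect_lie S \<longleftrightarrow> brackets S S = S"

definition lie_subalgebra :: "'g::complex_lie_algebra set \<Rightarrow> bool" where
  "lie_subalgebra S \<longleftrightarrow> cvec.subspace S \<and> (\<forall>x\<in>S. \<forall>y\<in>S. lie x y \<in> S)"

definition lie_ideal :: "'g::complex_lie_algebra set \<Rightarrow> 'g set \<Rightarrow> bool" where
  "lie_ideal I S \<longleftrightarrow> cvec.subspace I \<and> I \<subseteq> S \<and> (\<forall>x\<in>S. \<forall>y\<in>I. lie x y \<in> I)"

primrec derived_series :: "nat \<Rightarrow> 'g::complex_lie_algebra set \<Rightarrow> 'g set" where
  "derived_series 0 S = S"
| "derived_series (Suc i) S = brackets (derived_series i S) (derived_series i S)"

definition solvable_lie :: "'g::complex_lie_algebra set \<Rightarrow> bool" where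
  "solvable_lie S \<longleftrightarrow> (\<exists>i. derived_series i S = {0})"

definition is_radical :: "'g::complex_lie_algebra set \<Rightarrow> 'g set \<Rightarrow> bool" where
  "is_radical R S \<longleftrightarrow> lie_ideal R S \<and> solvable_lie R \<and>
     (\<forall>I. lie_ideal I S \<and> solvable_lie I \<longrightarrow> I \<subseteq> R)"

definition semisimple_lie :: "'g::complex_lie_algebra set \<Rightarrow> bool" where
  "semisimple_lie S \<longleftrightarrow> lie_subalgebra S \<and> is_radical {0} S"

definition simple_lie :: "'g::complex_lie_algebra set \<Rightarrow> bool" where
  "simple_lie S \<longleftrightarrow> lie_subalgebra S \<and> brackets S S \<noteq> {0} \<and>
     (\<forall>I. lie_ideal I S \<longrightarrow> I = {0} \<or> I = S)"

definition lie_center :: "'g::complex_lie_algebra set \<Rightarrow> 'g set" where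
  "lie_center S = {x \<in> S. \<forall>y\<in>S. lie x y = 0}"

text \<open>Internal direct sum of a list of subspaces: every element of \<open>H\<close> is, in exactly one way,
  a sum with one term from each listed subspace.\<close>

definition is_direct_sum :: "'g::complex_vector set \<Rightarrow> 'g set list \<Rightarrow> bool" where
  "is_direct_sum H Vs \<longleftrightarrow> (\<forall>V\<in>set Vs. cvec.subspace V) \<and>
     bij_betw (\<lambda>v. \<Sum>i<length Vs. v i) (\<Pi>\<^sub>E i\<in>{..<length Vs}. Vs ! i) H"

definition levi_decomposition :: "'g::complex_lie_algebra set \<Rightarrow> 'g set \<Rightarrow> bool" where
  "levi_decomposition L R \<longleftrightarrow>
     semisimple_lie L \<and> is_radical R UNIV \<and> is_direct_sum UNIV [L, R]"

text \<open>Submodules for the action of \<open>L\<close> by the Lie bracket.\<close>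

definition lie_submodule :: "'g::complex_lie_algebra set \<Rightarrow> 'g set \<Rightarrow> bool" where
  "lie_submodule L W \<longleftrightarrow> cvec.subspace W \<and> (\<forall>x\<in>L. \<forall>w\<in>W. lie x w \<in> W)"

definition simple_submodule :: "'g::complex_lie_algebra set \<Rightarrow> 'g set \<Rightarrow> bool" where
  "simple_submodule L W \<longleftrightarrow> lie_submodule L W \<and> W \<noteq> {0} \<and>
     (\<forall>U. lie_submodule L U \<and> U \<subseteq> W \<longrightarrow> U = {0} \<or> U = W)"

text \<open>\<open>P\<close> collects unordered pairs \<open>{X, Y}\<close> of summands; \<open>{X}\<close> stands for the pair of \<open>X\<close> with itself.\<close>

definition unlisted_brackets_zero ::
    "'g::complex_lie_algebra set set \<Rightarrow> 'g set set set \<Rightarrow> bool" where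
  "unlisted_brackets_zero S P \<longleftrightarrow>
     (\<forall>X\<in>S. \<forall>Y\<in>S. {X, Y} \<notin> P \<longrightarrow> brackets X Y = {0})"

end

theory Submission
  imports Defs "HOL-Computational_Algebra.Fundamental_Theorem_Algebra"
begin

text \<open>Perfectness gives \<open>H = [\<gg>, H]\<close>. By a version of Lie's theorem, a solvable ideal acts by
  scalars on each irreducible quotient \<open>I / J\<close> of ideals, and brackets \<open>[x, a]\<close> with \<open>a \<in> H\<close> act
  by the scalar \<open>0\<close>; so \<open>[H, I]\<close> is smaller than \<open>I\<close> for every nonzero ideal \<open>I\<close> and \<open>H\<close> is
  nilpotent. Hence a nonzero bracket of two summands is a summand strictly deeper in the lower
  central series than both of them. Ordering \<open>V\<^sub>n, V\<^sub>m, V\<^sub>p\<close> by depth leaves few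
  multiplication tables, which the Jacobi identity for subspaces and the noncentrality of
  \<open>V\<^sub>n, V\<^sub>m, V\<^sub>p\<close> reduce to the listed ones.\<close>

section \<open>Nilpotency of the radical\<close>

text \<open>Quotients \<open>I / J\<close> are never formed: a nonzero vector of the quotient is a
  vector of \<open>I\<close> outside \<open>J\<close>, and equations hold up to an element of
  \<open>J\<close>. Weights are compared under brackets with every \<open>x\<close> of the whole
  algebra, not just of \<open>H\<close>, because perfectness gives \<open>H = [g, H]\<close> and not
  \<open>H = [H, H]\<close>; this is why \<open>A\<close>, \<open>I\<close>, \<open>J\<close> and
  the weight space are ideals of the whole algebra and irreducibility refers to such ideals. Depth
  alone does not fix the labels of the tables, since the deepest summand may fail to be a product.
  If, in order of depth, \<open>[V_n, V_n] = V_m\<close> but \<open>[V_n, V_m]\<close> is not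
  \<open>V_p\<close>, then \<open>V_p\<close> acts as a second generator next to \<open>V_n\<close>,
  and the table is of type (3) with \<open>V_m\<close> as the derived summand. Tables with two
  generators are therefore analysed under conditions symmetric in the generators, and only
  afterwards combined with the order by depth.\<close>

definition lie_basis :: "'g::complex_lie_algebra set" where
  "lie_basis = (SOME B. cvec.independent B \<and> finite B \<and> cvec.span B = UNIV)"

text \<open>Dimension theory takes a basis as a parameter, while the class provides only a finite
  spanning set; a basis extracted from it and fixed by choice makes \<open>cvec.dim\<close> usable
  as a termination measure.\<close>

global_interpretation lie_fd: finite_dimensional_vector_space
  "scaleC :: complex \<Rightarrow> 'g \<Rightarrow> 'g::complex_lie_algebra" lie_basis
proof -
  obtain B :: "'g set" where B: "finite B" "\<And>x. \<exists>c. x = (\<Sum>b\<in>B. c b *\<^sub>C b)"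
    using finite_dim by blast
  have spB: "cvec.span B = UNIV"
  proof -
    have "x \<in> cvec.span B" for x
    proof -
      obtain c where "x = (\<Sum>b\<in>B. c b *\<^sub>C b)" using B(2) by blast
      then show ?thesis
        by (simp add: cvec.span_sum cvec.span_scale cvec.span_base)
    qed
    then show ?thesis by blast
  qed
  obtain B' where B': "B' \<subseteq> B" "cvec.independent B'" "B \<subseteq> cvec.span B'"
    using cvec.maximal_independent_subset[of B] by blast
  have "cvec.span B' = UNIV"
    using cvec.span_minimal[OF B'(3) cvec.subspace_span] spB by blast
  then have "\<exists>B. cvec.independent B \<and> finite B \<and> cvec.span B = (UNIV :: 'g set)"
    using B' B(1) finite_subset by blast
  then have "cvec.independent (lie_basis :: 'g set) \<and> finite (lie_basis :: 'g set)
      \<and> cvec.span lie_basis = (UNIV :: 'g set)"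
    unfolding lie_basis_def by (rule someI_ex)
  then show "finite_dimensional_vector_space scaleC (lie_basis :: 'g set)"
    by unfold_locales simp_all
qed

text \<open>Otherwise each new vector raises the dimension, past that of the whole space. Carrying
  \<open>J\<close> along makes this a dependence modulo \<open>J\<close>; the sequence is arbitrary
  because it serves both for powers of an operator and for iterated brackets.\<close>

lemma krylov_stationary:
  fixes u :: "nat \<Rightarrow> 'g::complex_lie_algebra"
  shows "\<exists>i. u i \<in> cvec.span (J \<union> u ` {..<i})"
proof (rule ccontr)
  assume "\<nexists>i. u i \<in> cvec.span (J \<union> u ` {..<i})"
  then have no: "u i \<notin> cvec.span (J \<union> u ` {..<i})" for i by blast
  have "i \<le> cvec.dim (J \<union> u ` {..<i})" for i
  proof (induction i)
    case (Suc i)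
    have "cvec.span (J \<union> u ` {..<i}) \<subset> cvec.span (J \<union> u ` {..<Suc i})"
    proof
      show "cvec.span (J \<union> u ` {..<i}) \<subseteq> cvec.span (J \<union> u ` {..<Suc i})"
        by (rule cvec.span_mono) auto
      have "u i \<in> cvec.span (J \<union> u ` {..<Suc i})" by (rule cvec.span_base) auto
      then show "cvec.span (J \<union> u ` {..<i}) \<noteq> cvec.span (J \<union> u ` {..<Suc i})"
        using no by blast
    qed
    from lie_fd.dim_psubset[OF this] show ?case using Suc by linarith
  qed simp
  from this[of "Suc (cvec.dim (UNIV :: 'g set))"]
  show False
    using lie_fd.dim_subset[OF subset_UNIV] by (meson Suc_n_not_le_n le_trans)
qed

lemma span_subspace_induct:
  assumes "x \<in> cvec.span S" "S \<subseteq> {y. P y}" "P 0"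
    "\<And>x y. P x \<Longrightarrow> P y \<Longrightarrow> P (x + y)" "\<And>c x. P x \<Longrightarrow> P (c *\<^sub>C x)"
  shows "P x"
proof -
  have "cvec.subspace {y. P y}" using assms(3-5) by (auto intro: cvec.subspaceI)
  then show ?thesis using assms(1,2) cvec.span_minimal by blast
qed

section \<open>Bracket identities and vanishing weights\<close>

lemma lie_zero_left [simp]: "lie 0 (x::'g::complex_lie_algebra) = 0"
  using lie_add_left[of 0 0 x] by simp

lemma lie_zero_right [simp]: "lie (x::'g::complex_lie_algebra) 0 = 0"
  using lie_add_right[of x 0 0] by simp

lemma lie_swap: "lie y x = - lie x (y::'g::complex_lie_algebra)"
proof -
  have "lie x y + lie y x = lie (x + y) (x + y)"
    unfolding lie_add_left lie_add_right by (simp add: lie_self)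
  then have "lie x y + lie y x = 0" by (simp add: lie_self)
  then show ?thesis by (simp add: eq_neg_iff_add_eq_0 add.commute)
qed

lemma lie_minus_right: "lie x (- y) = - lie x (y::'g::complex_lie_algebra)"
  using lie_add_right[of x y "-y"] by (simp add: eq_neg_iff_add_eq_0 add.commute)

lemma lie_diff_right: "lie x (y - z) = lie x y - lie x (z::'g::complex_lie_algebra)"
  by (simp add: diff_conv_add_uminus lie_add_right lie_minus_right del: add_uminus_conv_diff)

text \<open>This moves \<open>a\<close> past \<open>x\<close>. The correction is written with
  \<open>lie x a\<close>, not \<open>lie a x\<close>, because the sets of operators considered later
  are closed under \<open>lie x\<close>.\<close>

lemma lie_jacobi_derivation:
  "lie a (lie x u) = lie x (lie a u) - lie (lie x a) (u::'g::complex_lie_algebra)"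
proof -
  have "lie a (lie x u) + lie x (lie u a) + lie u (lie a x) = 0" by (rule jacobi)
  moreover have "lie x (lie u a) = - lie x (lie a u)"
    by (simp add: lie_swap[of u a] lie_minus_right)
  moreover have "lie u (lie a x) = lie (lie x a) u"
    by (simp add: lie_swap[of "lie x a" u] lie_swap[of a x] lie_minus_right)
  ultimately show ?thesis by (simp add: algebra_simps eq_neg_iff_add_eq_0)
qed

text \<open>The chain \<open>v, [x, v], [x, [x, v]], \<dots>\<close> is triangular modulo \<open>J\<close> for every
  \<open>a \<in> A\<close>, with \<open>- i \<omega>[x, a]\<close> just above the diagonal; a nonzero entry there would make
  the chain infinite. This replaces the trace argument in Lie's theorem.\<close>

lemma weight_bracket_zero:
  fixes J A :: "'g::complex_lie_algebra set"
  assumes J: "lie_ideal J UNIV"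
    and closed: "\<And>a. a \<in> A \<Longrightarrow> lie x a \<in> A"
    and weight: "\<And>a. a \<in> A \<Longrightarrow> lie a v - \<omega> a *\<^sub>C v \<in> J"
    and v: "v \<notin> J" and a: "a \<in> A"
  shows "\<omega> (lie x a) = 0"
proof -
  have sJ: "cvec.subspace J" and iJ: "\<And>y z. z \<in> J \<Longrightarrow> lie y z \<in> J"
    using J by (auto simp: lie_ideal_def)
  define u where "u i = (lie x ^^ i) v" for i
  \<comment> \<open>\<open>W i\<close> uses only the first \<open>i\<close> chain vectors, so
    \<open>W 0 = J\<close>, and \<open>u i\<close> is a generator of \<open>W (Suc i)\<close>, not
    of \<open>W i\<close>.\<close>
  define W where "W i = cvec.span (J \<union> u ` {..<i})" for i
  have u0: "u 0 = v" and uS: "u (Suc i) = lie x (u i)" for i by (auto simp: u_def)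
  have sW: "cvec.subspace (W i)" for i by (simp add: W_def)
  have W0: "W 0 = J" using sJ by (simp add: W_def cvec.span_eq_iff)
  have W_mono: "W i \<subseteq> W j" if "i \<le> j" for i j
    using that unfolding W_def by (intro cvec.span_mono) auto
  have uW: "u i \<in> W j" if "i < j" for i j
    using that unfolding W_def by (intro cvec.span_base) auto
  have JW: "J \<subseteq> W i" for i using W_mono[of 0 i] W0 by simp
  have xW: "lie x w \<in> W (Suc i)" if "w \<in> W i" for w i
    using that unfolding W_def
  proof (rule span_subspace_induct)
    show "J \<union> u ` {..<i} \<subseteq> {y. lie x y \<in> cvec.span (J \<union> u ` {..<Suc i})}"
    proof (clarsimp, safe)
      fix y assume "y \<in> J" then show "lie x y \<in> cvec.span (J \<union> u ` {..<Suc i})"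
        using iJ by (auto intro: cvec.span_base)
    next
      fix j assume "j < i" then show "lie x (u j) \<in> cvec.span (J \<union> u ` {..<Suc i})"
        by (auto intro!: cvec.span_base simp: uS[symmetric])
    qed
  qed (auto simp: cvec.span_zero lie_add_right lie_scaleC_right
        intro: cvec.span_add cvec.span_scale)
  \<comment> \<open>The second conjunct at \<open>i\<close> yields the first at
    \<open>Suc i\<close>, since its extra term lies in \<open>W (Suc i)\<close>; it also records the
    entry just above the diagonal. The claim ranges over all of \<open>A\<close> because the step
    for \<open>a\<close> needs it for \<open>lie x a\<close>.\<close>
  have main: "lie a (u i) - \<omega> a *\<^sub>C u i \<in> W i \<and>
      lie a (u (Suc i)) - \<omega> a *\<^sub>C u (Suc i) + of_nat (Suc i) *\<^sub>C \<omega> (lie x a) *\<^sub>C u i \<in> W i"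
    if "a \<in> A" for a i
    using that
  proof (induction i arbitrary: a)
    case 0
    have 1: "lie a v - \<omega> a *\<^sub>C v \<in> J" using weight 0 by blast
    have 2: "lie (lie x a) v - \<omega> (lie x a) *\<^sub>C v \<in> J" using weight closed 0 by blast
    have "lie a (u (Suc 0)) - \<omega> a *\<^sub>C u (Suc 0) + of_nat (Suc 0) *\<^sub>C \<omega> (lie x a) *\<^sub>C u 0
      = lie x (lie a v - \<omega> a *\<^sub>C v) - (lie (lie x a) v - \<omega> (lie x a) *\<^sub>C v)"
      by (simp add: uS u0 lie_jacobi_derivation[of a x v] lie_diff_right lie_scaleC_right
          algebra_simps scaleC_one)
    moreover have "\<dots> \<in> J" by (rule cvec.subspace_diff[OF sJ iJ[OF 1] 2])
    ultimately have "lie a (u (Suc 0)) - \<omega> a *\<^sub>C u (Suc 0)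
        + of_nat (Suc 0) *\<^sub>C \<omega> (lie x a) *\<^sub>C u 0 \<in> J" by (rule ssubst)
    with 1 show ?case unfolding W0 u0 by (rule conjI)
  next
    case (Suc i)
    let ?c = "\<omega> (lie x a)"
    let ?b = "lie x a"
    define w where "w = lie a (u (Suc i)) - \<omega> a *\<^sub>C u (Suc i) + of_nat (Suc i) *\<^sub>C ?c *\<^sub>C u i"
    have w: "w \<in> W i" using Suc unfolding w_def by blast
    have 1: "lie a (u (Suc i)) - \<omega> a *\<^sub>C u (Suc i) \<in> W (Suc i)" if "a \<in> A" for a
    proof -
      have "lie a (u (Suc i)) - \<omega> a *\<^sub>C u (Suc i) + of_nat (Suc i) *\<^sub>C \<omega> (lie x a) *\<^sub>C u i \<in> W (Suc i)"
        using Suc.IH[OF that] W_mono[of i "Suc i"] by auto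
      moreover have "of_nat (Suc i) *\<^sub>C \<omega> (lie x a) *\<^sub>C u i \<in> W (Suc i)"
        using sW uW[of i "Suc i"] by (auto intro!: cvec.subspace_scale)
      ultimately have "lie a (u (Suc i)) - \<omega> a *\<^sub>C u (Suc i) + of_nat (Suc i) *\<^sub>C \<omega> (lie x a) *\<^sub>C u i
          - of_nat (Suc i) *\<^sub>C \<omega> (lie x a) *\<^sub>C u i \<in> W (Suc i)"
        by (rule cvec.subspace_diff[OF sW])
      then show ?thesis by (simp only: add_diff_cancel_right')
    qed
    \<comment> \<open>Of the \<open>Suc (Suc i)\<close> copies of the off-diagonal term,
      \<open>Suc i\<close> come from applying \<open>lie x\<close> to \<open>w\<close> and one from
      the correction \<open>lie ?b (u (Suc i))\<close>.\<close>
    have split: "of_nat (Suc (Suc i)) *\<^sub>C z = of_nat (Suc i) *\<^sub>C z + z" for z :: 'g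
      by (simp only: of_nat_Suc[of "Suc i"] scaleC_add_left scaleC_one add.commute)
    have "lie a (u (Suc (Suc i))) - \<omega> a *\<^sub>C u (Suc (Suc i)) + of_nat (Suc (Suc i)) *\<^sub>C ?c *\<^sub>C u (Suc i)
      = lie x w - (lie ?b (u (Suc i)) - ?c *\<^sub>C u (Suc i))"
      unfolding w_def split
      by (simp add: uS lie_jacobi_derivation[of a x "lie x (u i)"] lie_diff_right lie_add_right
          lie_scaleC_right del: of_nat_Suc cvec.scale_scale)
    moreover have "\<dots> \<in> W (Suc i)"
      using xW[OF w] 1[OF closed[OF Suc.prems]] by (rule cvec.subspace_diff[OF sW])
    ultimately show ?case using 1[OF Suc.prems] by simp
  qed
  show ?thesis
  proof (rule ccontr)
    assume nz: "\<omega> (lie x a) \<noteq> 0"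
    \<comment> \<open>The first index at which the chain closes up; it is positive because
      \<open>v\<close> lies outside \<open>J = W 0\<close>.\<close>
    define i where "i = (LEAST i. u i \<in> W i)"
    have ui: "u i \<in> W i" unfolding i_def
      using krylov_stationary[of u J] unfolding W_def by (rule LeastI_ex)
    have least: "u j \<notin> W j" if "j < i" for j using that not_less_Least unfolding i_def by blast
    have "i \<noteq> 0" using ui v u0 W0 by metis
    then obtain k where k: "i = Suc k" using not0_implies_Suc by blast
    have TW: "lie a w - \<omega> a *\<^sub>C w \<in> W k" if "w \<in> W (Suc k)" for w
      using that unfolding W_def[of "Suc k"]
    proof (rule span_subspace_induct)
      show "J \<union> u ` {..<Suc k} \<subseteq> {w. lie a w - \<omega> a *\<^sub>C w \<in> W k}"
      proof (clarsimp, safe)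
        fix y assume "y \<in> J"
        then have "lie a y - \<omega> a *\<^sub>C y \<in> J"
          using iJ sJ by (simp add: cvec.subspace_diff cvec.subspace_scale)
        then show "lie a y - \<omega> a *\<^sub>C y \<in> W k" using JW by blast
      next
        fix j assume "j < Suc k"
        then show "lie a (u j) - \<omega> a *\<^sub>C u j \<in> W k"
          using main[OF a, of j] W_mono[of j k] by auto
      qed
    next
      show "lie a 0 - \<omega> a *\<^sub>C 0 \<in> W k" by (simp add: cvec.subspace_0[OF sW])
    next
      fix y z assume "lie a y - \<omega> a *\<^sub>C y \<in> W k" "lie a z - \<omega> a *\<^sub>C z \<in> W k"
      from cvec.subspace_add[OF sW this]
      show "lie a (y + z) - \<omega> a *\<^sub>C (y + z) \<in> W k"
        by (simp add: lie_add_right algebra_simps)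
    next
      fix c y assume "lie a y - \<omega> a *\<^sub>C y \<in> W k"
      from cvec.subspace_scale[OF sW this, of c]
      show "lie a (c *\<^sub>C y) - \<omega> a *\<^sub>C (c *\<^sub>C y) \<in> W k"
        by (simp add: lie_scaleC_right cvec.scale_right_diff_distrib algebra_simps)
    qed
    \<comment> \<open>The closing vector lies in \<open>W (Suc k)\<close>, so
      \<open>a - \<omega> a\<close> sends it into \<open>W k\<close>; by \<open>main\<close> the
      same image is \<open>- Suc k * \<omega> (lie x a)\<close> times \<open>u k\<close> modulo
      \<open>W k\<close>. In characteristic zero that factor is invertible, which puts
      \<open>u k\<close> into \<open>W k\<close> against minimality.\<close>
    have "lie a (u (Suc k)) - \<omega> a *\<^sub>C u (Suc k) \<in> W k" using TW ui k by blast
    from cvec.subspace_diff[OF sW conjunct2[OF main[OF a, of k]] this]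
    have "(of_nat (Suc k) * \<omega> (lie x a)) *\<^sub>C u k \<in> W k" by (simp add: scaleC_scaleC)
    then have "inverse (of_nat (Suc k) * \<omega> (lie x a)) *\<^sub>C
        (of_nat (Suc k) * \<omega> (lie x a)) *\<^sub>C u k \<in> W k"
      by (rule cvec.subspace_scale[OF sW])
    moreover have "of_nat (Suc k) * \<omega> (lie x a) \<noteq> 0"
      using nz of_nat_neq_0 by (metis mult_eq_0_iff)
    ultimately have "u k \<in> W k"
      by (simp only: scaleC_scaleC left_inverse[OF \<open>of_nat (Suc k) * \<omega> (lie x a) \<noteq> 0\<close>] scaleC_one)
    then show False using least[of k] k by simp
  qed
qed

section \<open>Eigenvectors modulo a subspace\<close>

definition poly_op :: "('a::complex_vector \<Rightarrow> 'a) \<Rightarrow> complex poly \<Rightarrow> 'a \<Rightarrow> 'a" where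
  "poly_op T p u = (\<Sum>i\<le>degree p. coeff p i *\<^sub>C (T ^^ i) u)"

lemma poly_op_altdef:
  assumes "degree p \<le> n"
  shows "poly_op T p u = (\<Sum>i\<le>n. coeff p i *\<^sub>C (T ^^ i) u)"
  unfolding poly_op_def
  by (rule sum.mono_neutral_left) (use assms in \<open>auto simp: coeff_eq_0\<close>)

lemma poly_op_linear_factor:
  assumes T: "module_hom scaleC scaleC T"
  shows "poly_op T ([:- \<mu>, 1:] * q) u = T (poly_op T q u) - \<mu> *\<^sub>C poly_op T q u"
proof -
  let ?n = "Suc (degree q)"
  have d: "degree ([:- \<mu>, 1:] * q) \<le> ?n"
    using degree_mult_le[of "[:- \<mu>, 1:]" q] by simp
  have c: "coeff ([:- \<mu>, 1:] * q) i = (case i of 0 \<Rightarrow> 0 | Suc j \<Rightarrow> coeff q j) - \<mu> * coeff q i" for i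
    by (simp add: coeff_pCons split: nat.split)
  have "poly_op T ([:- \<mu>, 1:] * q) u = (\<Sum>i\<le>?n. coeff ([:- \<mu>, 1:] * q) i *\<^sub>C (T ^^ i) u)"
    by (rule poly_op_altdef[OF d])
  also have "\<dots> = (\<Sum>i\<le>?n. (case i of 0 \<Rightarrow> 0 | Suc j \<Rightarrow> coeff q j) *\<^sub>C (T ^^ i) u)
      - \<mu> *\<^sub>C (\<Sum>i\<le>?n. coeff q i *\<^sub>C (T ^^ i) u)"
    unfolding c by (simp only: cvec.scale_left_diff_distrib sum_subtractf cvec.scale_sum_right scaleC_scaleC)
  also have "(\<Sum>i\<le>?n. coeff q i *\<^sub>C (T ^^ i) u) = poly_op T q u"
    by (rule poly_op_altdef[symmetric]) simp
  also have "(\<Sum>i\<le>?n. (case i of 0 \<Rightarrow> 0 | Suc j \<Rightarrow> coeff q j) *\<^sub>C (T ^^ i) u) = T (poly_op T q u)"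
    unfolding sum.atMost_Suc_shift poly_op_def
    by (simp add: module_hom.sum[OF T] module_hom.scale[OF T])
  finally show ?thesis .
qed

lemma poly_op_in_subspace:
  assumes "cvec.subspace I" "\<And>w. w \<in> I \<Longrightarrow> T w \<in> I" "u \<in> I"
  shows "poly_op T p u \<in> I"
proof -
  have "(T ^^ i) u \<in> I" for i by (induction i) (use assms in auto)
  then show ?thesis unfolding poly_op_def
    by (intro cvec.subspace_sum cvec.subspace_scale assms(1)) auto
qed

text \<open>Among all nonzero polynomials sending some vector of \<open>I - J\<close> into
  \<open>J\<close>, take one of least degree. A root \<open>\<mu>\<close> splits off a linear
  factor, and minimality keeps the value of the remaining factor outside \<open>J\<close>; that
  value is the eigenvector.\<close>

lemma eigenvector_mod:
  fixes T :: "'g::complex_lie_algebra \<Rightarrow> 'g"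
  assumes T: "module_hom scaleC scaleC T"
    and sI: "cvec.subspace I" and sJ: "cvec.subspace J"
    and TI: "\<And>w. w \<in> I \<Longrightarrow> T w \<in> I" and JI: "J \<subset> I"
  shows "\<exists>v \<mu>. v \<in> I \<and> v \<notin> J \<and> T v - \<mu> *\<^sub>C v \<in> J"
proof -
  let ?P = "\<lambda>p. p \<noteq> 0 \<and> (\<exists>u\<in>I - J. poly_op T p u \<in> J)"
  obtain u where u: "u \<in> I" "u \<notin> J" using JI by blast
  obtain i where "(T ^^ i) u \<in> cvec.span (J \<union> (\<lambda>j. (T ^^ j) u) ` {..<i})"
    using krylov_stationary[of "\<lambda>j. (T ^^ j) u"] by blast
  \<comment> \<open>Membership in the span becomes explicit coefficients on the chain; the
    contribution of \<open>J\<close> is absorbed by working modulo \<open>J\<close>.\<close>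
  then have "\<exists>c. (T ^^ i) u - (\<Sum>j<i. c j *\<^sub>C (T ^^ j) u) \<in> J"
  proof (rule span_subspace_induct)
    show "J \<union> (\<lambda>j. (T ^^ j) u) ` {..<i} \<subseteq> {y. \<exists>c. y - (\<Sum>j<i. c j *\<^sub>C (T ^^ j) u) \<in> J}"
    proof safe
      fix y assume "y \<in> J"
      then have "y - (\<Sum>j<i. 0 *\<^sub>C (T ^^ j) u) \<in> J" by simp
      then show "\<exists>c. y - (\<Sum>j<i. c j *\<^sub>C (T ^^ j) u) \<in> J" by (intro exI[of _ "\<lambda>_. 0"])
    next
      fix k assume "k < i"
      have "(\<Sum>j<i. (if j = k then 1 else 0) *\<^sub>C (T ^^ j) u)
          = (\<Sum>j<i. if j = k then (T ^^ j) u else 0)"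
        by (rule sum.cong) (auto simp: scaleC_one)
      also have "\<dots> = (T ^^ k) u" using \<open>k < i\<close> by simp
      finally show "\<exists>c. (T ^^ k) u - (\<Sum>j<i. c j *\<^sub>C (T ^^ j) u) \<in> J"
        using cvec.subspace_0[OF sJ] by (intro exI[of _ "\<lambda>j. if j = k then 1 else 0"]) simp
    qed
  next
    show "\<exists>c. 0 - (\<Sum>j<i. c j *\<^sub>C (T ^^ j) u) \<in> J"
      using cvec.subspace_0[OF sJ] by (intro exI[of _ "\<lambda>_. 0"]) simp
  next
    fix x y assume "\<exists>c. x - (\<Sum>j<i. c j *\<^sub>C (T ^^ j) u) \<in> J"
      "\<exists>c. y - (\<Sum>j<i. c j *\<^sub>C (T ^^ j) u) \<in> J"
    then obtain c d where "x - (\<Sum>j<i. c j *\<^sub>C (T ^^ j) u) \<in> J"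
      "y - (\<Sum>j<i. d j *\<^sub>C (T ^^ j) u) \<in> J" by blast
    from cvec.subspace_add[OF sJ this]
    have "(x + y) - (\<Sum>j<i. (c j + d j) *\<^sub>C (T ^^ j) u) \<in> J"
      by (simp add: scaleC_add_left sum.distrib algebra_simps)
    then show "\<exists>c. (x + y) - (\<Sum>j<i. c j *\<^sub>C (T ^^ j) u) \<in> J"
      by (intro exI[of _ "\<lambda>j. c j + d j"])
  next
    fix a x assume "\<exists>c. x - (\<Sum>j<i. c j *\<^sub>C (T ^^ j) u) \<in> J"
    then obtain c where "x - (\<Sum>j<i. c j *\<^sub>C (T ^^ j) u) \<in> J" by blast
    from cvec.subspace_scale[OF sJ this, of a]
    have "a *\<^sub>C x - (\<Sum>j<i. (a * c j) *\<^sub>C (T ^^ j) u) \<in> J"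
      by (simp add: cvec.scale_right_diff_distrib cvec.scale_sum_right scaleC_scaleC)
    then show "\<exists>c. a *\<^sub>C x - (\<Sum>j<i. c j *\<^sub>C (T ^^ j) u) \<in> J"
      by (intro exI[of _ "\<lambda>j. a * c j"])
  qed
  then obtain c where c: "(T ^^ i) u - (\<Sum>j<i. c j *\<^sub>C (T ^^ j) u) \<in> J" by blast
  define p0 where "p0 = monom 1 i - (\<Sum>j<i. monom (c j) j)"
  have cf: "coeff p0 k = (if k = i then 1 else if k < i then - c k else 0)" for k
    by (auto simp: p0_def coeff_sum)
  have "degree p0 \<le> i" by (rule degree_le) (auto simp: cf)
  then have "poly_op T p0 u = (\<Sum>j\<le>i. coeff p0 j *\<^sub>C (T ^^ j) u)" by (rule poly_op_altdef)
  also have "\<dots> = (\<Sum>j<i. coeff p0 j *\<^sub>C (T ^^ j) u) + coeff p0 i *\<^sub>C (T ^^ i) u"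
    by (simp only: lessThan_Suc_atMost[symmetric] sum.lessThan_Suc)
  also have "(\<Sum>j<i. coeff p0 j *\<^sub>C (T ^^ j) u) = - (\<Sum>j<i. c j *\<^sub>C (T ^^ j) u)"
    unfolding sum_negf[symmetric] by (rule sum.cong) (auto simp: cf)
  finally have "poly_op T p0 u \<in> J" using c by (simp add: cf scaleC_one)
  moreover have "p0 \<noteq> 0" using cf[of i] by auto
  ultimately have "?P p0" using u by blast
  then obtain p where p: "?P p" and p_min: "\<And>q. ?P q \<Longrightarrow> degree p \<le> degree q"
    using ex_has_least_nat[of ?P p0 degree] by blast
  obtain w where w: "w \<in> I" "w \<notin> J" "poly_op T p w \<in> J" using p by blast
  have "degree p \<noteq> 0"
  proof
    assume d: "degree p = 0"
    then have cw: "coeff p 0 *\<^sub>C w \<in> J" using w(3) by (simp add: poly_op_def)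
    have nz: "coeff p 0 \<noteq> 0" using d p by (metis leading_coeff_0_iff)
    have "inverse (coeff p 0) *\<^sub>C coeff p 0 *\<^sub>C w \<in> J" by (rule cvec.subspace_scale[OF sJ cw])
    then show False using nz w(2) by (simp add: scaleC_scaleC scaleC_one)
  qed
  then have "\<not> constant (poly p)" by (simp add: constant_degree)
  then obtain \<mu> where "poly p \<mu> = 0" using fundamental_theorem_of_algebra[of p] by blast
  then obtain q where q: "p = [:- \<mu>, 1:] * q" unfolding poly_eq_0_iff_dvd by (auto elim: dvdE)
  have q0: "q \<noteq> 0" using p q by auto
  have "degree p = Suc (degree q)" unfolding q using q0 by (subst degree_mult_eq) auto
  then have nq: "\<not> ?P q" using p_min[of q] by linarith
  have "poly_op T q w \<in> I" by (rule poly_op_in_subspace[OF sI TI w(1)])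
  moreover have "poly_op T q w \<notin> J" using nq q0 w by blast
  moreover have "T (poly_op T q w) - \<mu> *\<^sub>C poly_op T q w \<in> J"
    using w(3) unfolding q poly_op_linear_factor[OF T] .
  ultimately show ?thesis by blast
qed

lemma lie_module_hom: "module_hom scaleC scaleC (lie (a::'g::complex_lie_algebra))"
  by unfold_locales (simp_all add: lie_add_right lie_scaleC_right)

lemma subspace_psubset_dim:
  fixes U W :: "'g::complex_lie_algebra set"
  assumes "cvec.subspace U" "cvec.subspace W" "U \<subset> W"
  shows "cvec.dim U < cvec.dim W"
  using assms by (intro lie_fd.dim_psubset) (simp add: cvec.span_eq_iff[THEN iffD2])

section \<open>Scalar action of a solvable ideal on irreducible quotients\<close>

lemma lie_in_brackets: "a \<in> A \<Longrightarrow> b \<in> B \<Longrightarrow> lie a b \<in> brackets A B"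
  unfolding brackets_def by (intro cvec.span_base) auto

lemma subspace_brackets [simp]: "cvec.subspace (brackets A B)"
  by (simp add: brackets_def)

lemma brackets_minimal:
  assumes "cvec.subspace S" "\<And>a b. a \<in> A \<Longrightarrow> b \<in> B \<Longrightarrow> lie a b \<in> S"
  shows "brackets A B \<subseteq> S"
  unfolding brackets_def using assms by (intro cvec.span_minimal) auto

lemma lie_ideal_brackets:
  assumes "lie_ideal A UNIV" "lie_ideal B UNIV"
  shows "lie_ideal (brackets A B) UNIV"
proof -
  have "brackets A B \<subseteq> {y. lie x y \<in> brackets A B}" for x
  proof (rule brackets_minimal)
    show "cvec.subspace {y. lie x y \<in> brackets A B}"
      by (rule cvec.subspaceI) (auto simp: lie_add_right lie_scaleC_right
          intro: cvec.subspace_add cvec.subspace_scale cvec.subspace_0)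
    fix a b assume ab: "a \<in> A" "b \<in> B"
    have "lie a (lie x b) \<in> brackets A B" "lie (lie x a) b \<in> brackets A B"
      using assms ab by (auto simp: lie_ideal_def intro!: lie_in_brackets)
    then have "lie a (lie x b) + lie (lie x a) b \<in> brackets A B"
      by (simp add: cvec.subspace_add)
    then show "a \<in> A \<Longrightarrow> b \<in> B \<Longrightarrow> lie a b \<in> {y. lie x y \<in> brackets A B}"
      by (simp add: lie_jacobi_derivation[of a x b])
  qed
  then show ?thesis by (auto simp: lie_ideal_def)
qed

lemma lie_ideal_derived_series: "lie_ideal A UNIV \<Longrightarrow> lie_ideal (derived_series i A) UNIV"
  by (induction i) (auto intro: lie_ideal_brackets)

text \<open>Elements of \<open>A\<close> commute on \<open>I\<close> modulo \<open>J\<close>, so an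
  eigenspace modulo \<open>J\<close> of one of them is invariant under all. In an invariant
  \<open>W\<close> of least dimension properly above \<open>J\<close> such an eigenspace is
  everything; hence each element acts by a scalar and any vector of \<open>W - J\<close>
  works.\<close>

lemma common_eigenvector_mod:
  fixes A I J :: "'g::complex_lie_algebra set"
  assumes A: "lie_ideal A UNIV" and I: "lie_ideal I UNIV" and J: "lie_ideal J UNIV"
    and JI: "J \<subset> I"
    and comm: "\<And>a b w. a \<in> A \<Longrightarrow> b \<in> A \<Longrightarrow> w \<in> I \<Longrightarrow> lie (lie a b) w \<in> J"
  shows "\<exists>v. v \<in> I \<and> v \<notin> J \<and> (\<forall>a\<in>A. \<exists>\<mu>. lie a v - \<mu> *\<^sub>C v \<in> J)"
proof -
  let ?Q = "\<lambda>W. cvec.subspace W \<and> J \<subset> W \<and> W \<subseteq> I \<and> (\<forall>a\<in>A. \<forall>w\<in>W. lie a w \<in> W)"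
  have sJ: "cvec.subspace J" and iJ: "\<And>y z. z \<in> J \<Longrightarrow> lie y z \<in> J"
    using J by (auto simp: lie_ideal_def)
  have "?Q I" using I JI by (auto simp: lie_ideal_def)
  then obtain W where W: "?Q W" and W_min: "\<And>W'. ?Q W' \<Longrightarrow> cvec.dim W \<le> cvec.dim W'"
    using ex_has_least_nat[of ?Q I cvec.dim] by blast
  have ev: "\<exists>\<mu>. \<forall>w\<in>W. lie a w - \<mu> *\<^sub>C w \<in> J" if a: "a \<in> A" for a
  proof -
    obtain v \<mu> where v: "v \<in> W" "v \<notin> J" "lie a v - \<mu> *\<^sub>C v \<in> J"
      using eigenvector_mod[OF lie_module_hom, of W J a] W sJ a by blast
    define W' where "W' = {w \<in> W. lie a w - \<mu> *\<^sub>C w \<in> J}"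
    have sW': "cvec.subspace W'"
    proof (rule cvec.subspaceI)
      show "0 \<in> W'" using W sJ by (simp add: W'_def cvec.subspace_0)
    next
      fix x y assume xy: "x \<in> W'" "y \<in> W'"
      then have "(lie a x - \<mu> *\<^sub>C x) + (lie a y - \<mu> *\<^sub>C y) \<in> J"
        by (intro cvec.subspace_add[OF sJ]) (auto simp: W'_def)
      then show "x + y \<in> W'" using xy W
        by (simp add: W'_def lie_add_right algebra_simps cvec.subspace_add)
    next
      fix c x assume x: "x \<in> W'"
      then have "c *\<^sub>C (lie a x - \<mu> *\<^sub>C x) \<in> J"
        by (intro cvec.subspace_scale[OF sJ]) (auto simp: W'_def)
      then show "c *\<^sub>C x \<in> W'" using x W
        by (simp add: W'_def lie_scaleC_right cvec.scale_right_diff_distrib cvec.subspace_scale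
            scaleC_scaleC mult.commute)
    qed
    have "J \<subseteq> W'" using W iJ sJ
      by (auto simp: W'_def intro!: cvec.subspace_diff cvec.subspace_scale)
    then have JW': "J \<subset> W'" using v by (auto simp: W'_def)
    have inv: "lie b w \<in> W'" if b: "b \<in> A" and w: "w \<in> W'" for b w
    proof -
      have "w \<in> I" using w W by (auto simp: W'_def)
      then have "lie b (lie a w - \<mu> *\<^sub>C w) - lie (lie b a) w \<in> J"
        using iJ comm a b w by (intro cvec.subspace_diff[OF sJ]) (auto simp: W'_def)
      then have "lie a (lie b w) - \<mu> *\<^sub>C lie b w \<in> J"
        by (simp add: lie_jacobi_derivation[of a b w] lie_diff_right lie_scaleC_right algebra_simps)
      then show ?thesis using W w b by (auto simp: W'_def)
    qed
    have W'W: "W' \<subseteq> W" by (auto simp: W'_def)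
    moreover have "W \<subseteq> I" using W by simp
    ultimately have "W' \<subseteq> I" by (rule subset_trans)
    then have "?Q W'" using sW' JW' inv by simp
    from W_min[OF this] have "\<not> W' \<subset> W"
      using subspace_psubset_dim[OF sW', of W] W by (meson not_le)
    with W'W have "W' = W" by (simp add: psubset_eq)
    then show ?thesis by (auto simp: W'_def)
  qed
  obtain v where v: "v \<in> W" "v \<notin> J" using W by blast
  moreover have "v \<in> I" using v W by blast
  moreover have "\<forall>a\<in>A. \<exists>\<mu>. lie a v - \<mu> *\<^sub>C v \<in> J" using ev v(1) by meson
  ultimately show ?thesis by blast
qed

definition acts_by_scalars ::
    "'g::complex_lie_algebra set \<Rightarrow> 'g set \<Rightarrow> 'g set \<Rightarrow> bool" where
  "acts_by_scalars A I J \<longleftrightarrow> (\<forall>a\<in>A. \<exists>c. \<forall>v\<in>I. lie a v - c *\<^sub>C v \<in> J)"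

text \<open>The scalars of commutators vanish, because \<open>[a, b]\<close> has weight zero on an
  eigenvector of \<open>b\<close>; so \<open>A\<close> acts commutatively modulo \<open>J\<close>
  and has a common eigenvector. Its weight is zero on every \<open>lie x a\<close>, hence the weight
  space \<open>K\<close> is stable under the whole algebra, and irreducibility makes it all of
  \<open>I\<close>.\<close>

lemma acts_by_scalars_step:
  fixes A I J :: "'g::complex_lie_algebra set"
  assumes A: "lie_ideal A UNIV" and I: "lie_ideal I UNIV" and J: "lie_ideal J UNIV"
    and JI: "J \<subset> I"
    and irred: "\<And>K. lie_ideal K UNIV \<Longrightarrow> J \<subseteq> K \<Longrightarrow> K \<subseteq> I \<Longrightarrow> K = J \<or> K = I"
    and scal: "acts_by_scalars (brackets A A) I J"
  shows "acts_by_scalars A I J"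
proof -
  have sJ: "cvec.subspace J" and iJ: "\<And>y z. z \<in> J \<Longrightarrow> lie y z \<in> J"
    and sI: "cvec.subspace I" and iI: "\<And>y z. z \<in> I \<Longrightarrow> lie y z \<in> I"
    and iA: "\<And>y z. z \<in> A \<Longrightarrow> lie y z \<in> A"
    using I J A by (auto simp: lie_ideal_def)
  have comm: "lie (lie a b) w \<in> J" if a: "a \<in> A" and b: "b \<in> A" and w: "w \<in> I" for a b w
  proof -
    obtain v \<beta> where v: "v \<in> I" "v \<notin> J" "lie b v - \<beta> *\<^sub>C v \<in> J"
      using eigenvector_mod[OF lie_module_hom sI sJ iI JI, of b] by blast
    \<comment> \<open>Just large enough for the weight lemma: \<open>lie a\<close> sends
      \<open>b\<close> into \<open>[A, A]\<close> and preserves the latter, and \<open>v\<close> is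
      an eigenvector modulo \<open>J\<close> for all of these.\<close>
    let ?A = "insert b (brackets A A)"
    have "\<forall>z\<in>?A. \<exists>c. lie z v - c *\<^sub>C v \<in> J"
      using v scal by (auto simp: acts_by_scalars_def)
    then obtain \<omega> where \<omega>: "\<And>z. z \<in> ?A \<Longrightarrow> lie z v - \<omega> z *\<^sub>C v \<in> J" by metis
    have ab: "lie a b \<in> brackets A A" using a b by (rule lie_in_brackets)
    have "lie a z \<in> ?A" if "z \<in> ?A" for z
      using that ab lie_ideal_brackets[OF A A] by (auto simp: lie_ideal_def)
    from weight_bracket_zero[OF J this \<omega> v(2), of b]
    have "\<omega> (lie a b) = 0" by simp
    then have 1: "lie (lie a b) v \<in> J" using \<omega>[of "lie a b"] ab by simp
    obtain c where c: "\<And>v. v \<in> I \<Longrightarrow> lie (lie a b) v - c *\<^sub>C v \<in> J"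
      using scal ab unfolding acts_by_scalars_def by blast
    have cv: "c *\<^sub>C v \<in> J" using cvec.subspace_diff[OF sJ 1 c[OF v(1)]] by simp
    have "c = 0"
    proof (rule ccontr)
      assume "c \<noteq> 0"
      moreover have "inverse c *\<^sub>C c *\<^sub>C v \<in> J" by (rule cvec.subspace_scale[OF sJ cv])
      ultimately show False using v(2) by (simp add: scaleC_scaleC scaleC_one)
    qed
    then show ?thesis using c[OF w] by simp
  qed
  obtain v where v: "v \<in> I" "v \<notin> J" "\<forall>a\<in>A. \<exists>\<mu>. lie a v - \<mu> *\<^sub>C v \<in> J"
    using common_eigenvector_mod[OF A I J JI comm] by blast
  then obtain \<omega> where \<omega>: "\<And>a. a \<in> A \<Longrightarrow> lie a v - \<omega> a *\<^sub>C v \<in> J" by metis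
  have \<omega>0: "\<omega> (lie x a) = 0" if "a \<in> A" for x a
    using weight_bracket_zero[OF J iA \<omega> v(2) that] by simp
  define K where "K = {w \<in> I. \<forall>a\<in>A. lie a w - \<omega> a *\<^sub>C w \<in> J}"
  have sK: "cvec.subspace K"
  proof (rule cvec.subspaceI)
    show "0 \<in> K" using sI sJ by (simp add: K_def cvec.subspace_0)
  next
    fix x y assume xy: "x \<in> K" "y \<in> K"
    have "lie a (x + y) - \<omega> a *\<^sub>C (x + y) \<in> J" if "a \<in> A" for a
    proof -
      have "(lie a x - \<omega> a *\<^sub>C x) + (lie a y - \<omega> a *\<^sub>C y) \<in> J"
        using xy that by (intro cvec.subspace_add[OF sJ]) (auto simp: K_def)
      then show ?thesis by (simp add: lie_add_right algebra_simps)
    qed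
    then show "x + y \<in> K" using xy sI by (simp add: K_def cvec.subspace_add)
  next
    fix c x assume x: "x \<in> K"
    have "lie a (c *\<^sub>C x) - \<omega> a *\<^sub>C (c *\<^sub>C x) \<in> J" if "a \<in> A" for a
    proof -
      have "c *\<^sub>C (lie a x - \<omega> a *\<^sub>C x) \<in> J"
        using x that by (intro cvec.subspace_scale[OF sJ]) (auto simp: K_def)
      then show ?thesis
        by (simp add: lie_scaleC_right cvec.scale_right_diff_distrib scaleC_scaleC mult.commute)
    qed
    then show "c *\<^sub>C x \<in> K" using x sI by (simp add: K_def cvec.subspace_scale)
  qed
  have "lie x w \<in> K" if w: "w \<in> K" for x w
  proof -
    have "lie a (lie x w) - \<omega> a *\<^sub>C lie x w \<in> J" if a: "a \<in> A" for a
    proof -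
      have "lie (lie x a) w \<in> J" using w \<omega>0[OF a, of x] iA[OF a, of x] by (force simp: K_def)
      then have "lie x (lie a w - \<omega> a *\<^sub>C w) - lie (lie x a) w \<in> J"
        using w a iJ by (intro cvec.subspace_diff[OF sJ]) (auto simp: K_def)
      then show ?thesis
        by (simp add: lie_jacobi_derivation[of a x w] lie_diff_right lie_scaleC_right algebra_simps)
    qed
    then show ?thesis using w iI by (simp add: K_def)
  qed
  then have "lie_ideal K UNIV" using sK by (simp add: lie_ideal_def)
  moreover have "J \<subseteq> K" using JI iJ sJ
    by (auto simp: K_def intro!: cvec.subspace_diff cvec.subspace_scale)
  moreover have "K \<noteq> J" using v \<omega> by (auto simp: K_def)
  ultimately have "K = I" using irred by (auto simp: K_def)
  then show ?thesis unfolding acts_by_scalars_def K_def by blast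
qed

text \<open>The step lemma is climbed along the derived series, whose terms are all ideals of the
  whole algebra, with one fixed irreducible pair \<open>I\<close>, \<open>J\<close>.\<close>

lemma solvable_acts_by_scalars:
  fixes A I J :: "'g::complex_lie_algebra set"
  assumes A: "lie_ideal A UNIV" "solvable_lie A" and I: "lie_ideal I UNIV" and J: "lie_ideal J UNIV"
    and JI: "J \<subset> I"
    and irred: "\<And>K. lie_ideal K UNIV \<Longrightarrow> J \<subseteq> K \<Longrightarrow> K \<subseteq> I \<Longrightarrow> K = J \<or> K = I"
  shows "acts_by_scalars A I J"
proof -
  obtain n where n: "derived_series n A = {0}" using A(2) by (auto simp: solvable_lie_def)
  have "acts_by_scalars {0} I J"
    using J by (auto simp: acts_by_scalars_def lie_ideal_def cvec.subspace_0 intro!: exI[of _ 0])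
  \<comment> \<open>The index \<open>n - i\<close> counts down, so the induction starts at the zero
    term and ends at \<open>A\<close> itself.\<close>
  then have "acts_by_scalars (derived_series (n - i) A) I J" if "i \<le> n" for i
    using that
  proof (induction i)
    case (Suc i)
    then have "n - i = Suc (n - Suc i)" by simp
    then have "acts_by_scalars (brackets (derived_series (n - Suc i) A) (derived_series (n - Suc i) A)) I J"
      using Suc by simp
    then show ?case
      using acts_by_scalars_step[OF lie_ideal_derived_series[OF A(1)] I J JI] irred by blast
  qed (simp add: n)
  from this[of n] show ?thesis by simp
qed

lemma bracket_radical_proper:
  fixes H I :: "'g::complex_lie_algebra set"
  assumes H: "lie_ideal H UNIV" "solvable_lie H" and HH: "H \<subseteq> brackets UNIV H"
    and I: "lie_ideal I UNIV" and I0: "I \<noteq> {0}"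
  shows "brackets H I \<subset> I"
proof -
  let ?P = "\<lambda>J. lie_ideal J UNIV \<and> J \<subset> I"
  have "?P {0}" using I I0 by (auto simp: lie_ideal_def cvec.subspace_0)
  moreover have "\<forall>J. ?P J \<longrightarrow> cvec.dim J \<le> cvec.dim (UNIV :: 'g set)"
    using lie_fd.dim_subset[OF subset_UNIV] by blast
  \<comment> \<open>A proper subideal of largest dimension, so that no ideal fits strictly between
    \<open>J\<close> and \<open>I\<close>.\<close>
  ultimately obtain J where J: "?P J" and J_max: "\<And>K. ?P K \<Longrightarrow> cvec.dim K \<le> cvec.dim J"
    using ex_has_greatest_nat[of ?P "{0}" cvec.dim "Suc (cvec.dim (UNIV :: 'g set))"] by (auto simp: less_Suc_eq_le)
  have sJ: "cvec.subspace J" and iJ: "\<And>y z. z \<in> J \<Longrightarrow> lie y z \<in> J"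
    using J by (auto simp: lie_ideal_def)
  have "K = J \<or> K = I" if K: "lie_ideal K UNIV" "J \<subseteq> K" "K \<subseteq> I" for K
  proof (rule ccontr)
    assume "\<not> (K = J \<or> K = I)"
    then have "?P K" "J \<subset> K" using K by auto
    then show False using J_max[of K] subspace_psubset_dim[of J K] sJ K
      by (simp add: lie_ideal_def)
  qed
  then have "acts_by_scalars H I J"
    using solvable_acts_by_scalars[OF H I] J by blast
  then obtain \<omega> where \<omega>: "\<And>a v. a \<in> H \<Longrightarrow> v \<in> I \<Longrightarrow> lie a v - \<omega> a *\<^sub>C v \<in> J"
    unfolding acts_by_scalars_def by metis
  obtain v where v: "v \<in> I" "v \<notin> J" using J by blast
  have iH: "\<And>y z. z \<in> H \<Longrightarrow> lie y z \<in> H" using H by (auto simp: lie_ideal_def)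
  have "\<omega> (lie x a) = 0" if "a \<in> H" for x a
    using weight_bracket_zero[OF conjunct1[OF J] iH \<omega>[OF _ v(1)] v(2) that] by simp
  then have gen: "lie (lie x a) w \<in> J" if "a \<in> H" "w \<in> I" for x a w
    using \<omega>[OF iH[OF that(1)] that(2)] that by (metis cvec.scale_zero_left diff_zero)
  \<comment> \<open>The elements sending \<open>I\<close> into \<open>J\<close> form a subspace, so
    it suffices that the generators \<open>lie x a\<close> belong to it; \<open>HH\<close> then
    covers all of \<open>H\<close>.\<close>
  have "brackets UNIV H \<subseteq> {z. \<forall>w\<in>I. lie z w \<in> J}"
    by (rule brackets_minimal)
      (auto intro!: cvec.subspaceI simp: gen lie_add_left lie_scaleC_left
        cvec.subspace_0[OF sJ] cvec.subspace_add[OF sJ] cvec.subspace_scale[OF sJ])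
  then have "brackets H I \<subseteq> J" using HH by (intro brackets_minimal[OF sJ]) blast
  then show ?thesis using J by blast
qed

section \<open>Descent of the lower central series\<close>

primrec lower_central_series :: "nat \<Rightarrow> 'g::complex_lie_algebra set \<Rightarrow> 'g set" where
  "lower_central_series 0 H = H"
| "lower_central_series (Suc i) H = brackets H (lower_central_series i H)"

lemma radical_nilpotent:
  fixes H :: "'g::complex_lie_algebra set"
  assumes H: "lie_ideal H UNIV" "solvable_lie H" and HH: "H \<subseteq> brackets UNIV H"
  shows "\<exists>n. lower_central_series n H = {0}"
proof (rule ccontr)
  assume "\<nexists>n. lower_central_series n H = {0}"
  then have nz: "lower_central_series n H \<noteq> {0}" for n by blast
  have ideal: "lie_ideal (lower_central_series n H) UNIV" for n
    by (induction n) (auto intro: lie_ideal_brackets H)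
  have "cvec.dim (lower_central_series n H) + n \<le> cvec.dim H" for n
  proof (induction n)
    case (Suc n)
    have "lower_central_series (Suc n) H \<subset> lower_central_series n H"
      using bracket_radical_proper[OF H HH ideal nz] by simp
    then have "cvec.dim (lower_central_series (Suc n) H) < cvec.dim (lower_central_series n H)"
      using ideal by (intro subspace_psubset_dim) (auto simp: lie_ideal_def)
    then show ?case using Suc by simp
  qed simp
  from this[of "Suc (cvec.dim H)"] show False by simp
qed

section \<open>Direct sums and brackets of subspaces\<close>

text \<open>The sums of \<open>is_direct_sum\<close>, indexed by lists instead of extensional
  functions, which permits recursion over the summands and reordering of explicit lists.\<close>

definition list_sums :: "'a::complex_vector set list \<Rightarrow> 'a set" where
  "list_sums Vs = {sum_list vs | vs. list_all2 (\<in>) vs Vs}"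

text \<open>Summation is linear on tuples, so bijectivity splits into the image being
  \<open>H\<close> and the kernel being trivial; lists and extensional functions correspond through
  \<open>map\<close> and \<open>restrict\<close>.\<close>

lemma is_direct_sum_iff:
  "is_direct_sum H Vs \<longleftrightarrow> (\<forall>V\<in>set Vs. cvec.subspace V)
    \<and> H = list_sums Vs
    \<and> (\<forall>vs. list_all2 (\<in>) vs Vs \<longrightarrow> sum_list vs = 0 \<longrightarrow> (\<forall>v\<in>set vs. v = 0))"
proof -
  define n where "n = length Vs"
  define P where "P = (\<Pi>\<^sub>E i\<in>{..<n}. Vs ! i)"
  define S where "S v = (\<Sum>i<n. v i)" for v :: "nat \<Rightarrow> 'a"
  have S_list: "sum_list (map v [0..<n]) = S v" for v
    by (simp add: S_def interv_sum_list_conv_sum_set_nat atLeast0LessThan)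
  have list_P: "list_all2 (\<in>) (map v [0..<n]) Vs" if "\<forall>i<n. v i \<in> Vs ! i" for v
    using that by (auto simp: list_all2_conv_all_nth n_def)
  have P_list: "restrict ((!) vs) {..<n} \<in> P" if "list_all2 (\<in>) vs Vs" for vs
    using that by (auto simp: list_all2_conv_all_nth n_def P_def)
  have S_restrict: "S (restrict ((!) vs) {..<n}) = sum_list vs" if "list_all2 (\<in>) vs Vs" for vs
    using list_all2_lengthD[OF that]
    by (simp add: S_def n_def sum_list_sum_nth atLeast0LessThan)
  have image: "S ` P = {sum_list vs | vs. list_all2 (\<in>) vs Vs}"
  proof safe
    fix v assume "v \<in> P"
    then have "list_all2 (\<in>) (map v [0..<n]) Vs" by (intro list_P) (auto simp: P_def)
    then show "\<exists>vs. S v = sum_list vs \<and> list_all2 (\<in>) vs Vs" using S_list[of v] by metis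
  next
    fix vs assume "list_all2 (\<in>) vs Vs"
    then show "sum_list vs \<in> S ` P" using P_list S_restrict by (metis image_eqI)
  qed
  have kernel: "inj_on S P \<longleftrightarrow>
      (\<forall>vs. list_all2 (\<in>) vs Vs \<longrightarrow> sum_list vs = 0 \<longrightarrow> (\<forall>v\<in>set vs. v = 0))"
    if sub: "\<forall>V\<in>set Vs. cvec.subspace V"
  proof safe
    fix vs v assume inj: "inj_on S P" and vs: "list_all2 (\<in>) vs Vs" "sum_list vs = 0" "v \<in> set vs"
    have z: "list_all2 (\<in>) (replicate n 0) Vs"
      using sub by (auto simp: list_all2_conv_all_nth n_def cvec.subspace_0)
    have "S (restrict ((!) (replicate n 0)) {..<n}) = 0"
      by (simp add: S_def)
    then have "restrict ((!) vs) {..<n} = restrict ((!) (replicate n 0)) {..<n}"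
      using inj_onD[OF inj _ P_list[OF vs(1)] P_list[OF z]] S_restrict[OF vs(1)] vs(2) by simp
    then have "vs ! i = 0" if "i < n" for i
      using that by (metis lessThan_iff nth_replicate restrict_apply')
    then show "v = 0" using vs list_all2_lengthD[OF vs(1)] by (auto simp: in_set_conv_nth n_def)
  next
    assume ker: "\<forall>vs. list_all2 (\<in>) vs Vs \<longrightarrow> sum_list vs = 0 \<longrightarrow> (\<forall>v\<in>set vs. v = 0)"
    show "inj_on S P"
    proof (rule inj_onI)
      fix v w assume vw: "v \<in> P" "w \<in> P" "S v = S w"
      have "\<forall>i<n. v i - w i \<in> Vs ! i"
        using vw sub by (auto simp: P_def n_def intro!: cvec.subspace_diff)
      from list_P[OF this] have "list_all2 (\<in>) (map (\<lambda>i. v i - w i) [0..<n]) Vs" .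
      moreover have "sum_list (map (\<lambda>i. v i - w i) [0..<n]) = 0"
        unfolding S_list using vw(3) by (simp add: S_def sum_subtractf)
      ultimately have "\<forall>i<n. v i - w i = 0" using ker by fastforce
      then show "v = w" using vw by (intro PiE_ext[of v "{..<n}" _ w]) (auto simp: P_def)
    qed
  qed
  show ?thesis
    unfolding is_direct_sum_def bij_betw_def list_sums_def
    using image kernel by (auto simp: S_def[abs_def] P_def n_def)
qed

section \<open>Brackets of subspaces and depth\<close>

lemma brackets_commute: "brackets A B = brackets B A"
proof -
  have "brackets A B \<subseteq> brackets B A" for A B :: "'a set"
  proof (rule brackets_minimal)
    fix a b assume "a \<in> A" "b \<in> B"
    then have "- lie b a \<in> brackets B A" by (intro cvec.subspace_neg) (auto intro: lie_in_brackets)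
    then show "lie a b \<in> brackets B A" by (simp add: lie_swap[of a b])
  qed simp
  then show ?thesis by blast
qed

lemma brackets_mono: "A \<subseteq> A' \<Longrightarrow> B \<subseteq> B' \<Longrightarrow> brackets A B \<subseteq> brackets A' B'"
  by (rule brackets_minimal) (auto intro: lie_in_brackets)

lemma brackets_eq_0_iff: "brackets A B = {0} \<longleftrightarrow> (\<forall>a\<in>A. \<forall>b\<in>B. lie a b = 0)"
proof
  show "\<forall>a\<in>A. \<forall>b\<in>B. lie a b = 0" if "brackets A B = {0}"
    using that lie_in_brackets[of _ A _ B] by fast
  assume "\<forall>a\<in>A. \<forall>b\<in>B. lie a b = 0"
  then have "brackets A B \<subseteq> {0}" by (intro brackets_minimal) auto
  moreover have "0 \<in> brackets A B" by (rule cvec.subspace_0) simp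
  ultimately show "brackets A B = {0}" by blast
qed

text \<open>Elementwise, Jacobi expresses \<open>lie x (lie y z)\<close> through the two other
  double brackets. Phrased through vanishing, it needs no sums of subspaces and fits a table whose
  entries are single subspaces.\<close>

lemma brackets_jacobi:
  assumes "brackets Y (brackets X Z) = {0}" "brackets Z (brackets X Y) = {0}"
  shows "brackets X (brackets Y Z) = {0}"
proof -
  have "brackets Y Z \<subseteq> {w. \<forall>x\<in>X. lie x w = 0}"
  proof (rule brackets_minimal)
    show "cvec.subspace {w. \<forall>x\<in>X. lie x w = 0}"
      by (rule cvec.subspaceI) (auto simp: lie_add_right lie_scaleC_right)
    fix y z assume yz: "y \<in> Y" "z \<in> Z"
    have "lie x (lie y z) = 0" if x: "x \<in> X" for x
    proof -
      have "lie y (lie x z) = 0" "lie z (lie x y) = 0"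
        using assms x yz by (simp_all add: brackets_eq_0_iff[of _ "brackets _ _"] lie_in_brackets)
      moreover have "lie z (lie x y) = - lie (lie x y) z" by (rule lie_swap)
      ultimately show ?thesis using lie_jacobi_derivation[of y x z] by simp
    qed
    then show "lie y z \<in> {w. \<forall>x\<in>X. lie x w = 0}" by blast
  qed
  then show ?thesis by (subst brackets_eq_0_iff) blast
qed

text \<open>If \<open>X\<close> lies in term \<open>j\<close>, then \<open>[X, Y]\<close> lies in
  term \<open>j + 1\<close>, so a nonzero bracket leaves the series strictly later than
  \<open>X\<close>; \<open>brackets_commute\<close> gives the same for \<open>Y\<close>.\<close>

lemma lower_central_rank:
  fixes H :: "'g::complex_lie_algebra set"
  assumes nil: "lower_central_series n H = {0}"
  shows "\<exists>d :: 'g set \<Rightarrow> nat. \<forall>X Y. X \<subseteq> H \<longrightarrow> Y \<subseteq> H \<longrightarrow> brackets X Y \<subseteq> H \<longrightarrow>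
    brackets X Y \<noteq> {0} \<longrightarrow> d X < d (brackets X Y)"
proof (intro exI allI impI)
  \<comment> \<open>The first term that fails to contain \<open>V\<close>; it exists for every
    nonzero subspace, since the series reaches \<open>{0}\<close>.\<close>
  define d where "d V = (LEAST i. \<not> V \<subseteq> lower_central_series i H)" for V :: "'g set"
  fix X Y assume XY: "X \<subseteq> H" "Y \<subseteq> H" "brackets X Y \<subseteq> H" "brackets X Y \<noteq> {0}"
  have "0 \<in> brackets X Y" by (rule cvec.subspace_0) simp
  then have "\<not> brackets X Y \<subseteq> lower_central_series n H" using XY(4) nil by auto
  then have out: "\<not> brackets X Y \<subseteq> lower_central_series (d (brackets X Y)) H"
    unfolding d_def by (rule LeastI)
  show "d X < d (brackets X Y)"
  proof (rule ccontr)
    assume le: "\<not> d X < d (brackets X Y)"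
    show False
    proof (cases "d (brackets X Y)")
      case 0
      then show False using out XY by simp
    next
      case (Suc j)
      then have "j < d X" using le by simp
      then have "X \<subseteq> lower_central_series j H" unfolding d_def using not_less_Least by blast
      then have "brackets Y X \<subseteq> lower_central_series (Suc j) H"
        using brackets_mono[OF XY(2)] by simp
      then show False using out Suc brackets_commute[of X Y] by simp
    qed
  qed
qed

section \<open>Truncating and permuting direct sums\<close>

lemma list_sums_Nil [simp]: "list_sums [] = {0}"
  by (auto simp: list_sums_def)

lemma list_sums_Cons: "list_sums (V # Vs) = {x + y | x y. x \<in> V \<and> y \<in> list_sums Vs}"
proof safe
  fix u assume "u \<in> list_sums (V # Vs)"
  then show "\<exists>x y. u = x + y \<and> x \<in> V \<and> y \<in> list_sums Vs"
    by (fastforce simp: list_sums_def list_all2_Cons2)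
next
  fix x y assume "x \<in> V" "y \<in> list_sums Vs"
  then obtain vs where "list_all2 (\<in>) (x # vs) (V # Vs)" "sum_list (x # vs) = x + y"
    by (auto simp: list_sums_def)
  then show "x + y \<in> list_sums (V # Vs)" unfolding list_sums_def by (metis (mono_tags, lifting) mem_Collect_eq)
qed

lemma subspace_list_sums:
  "\<forall>V\<in>set Vs. cvec.subspace V \<Longrightarrow> cvec.subspace (list_sums Vs)"
proof (induction Vs)
  case Nil
  then show ?case by (simp add: cvec.subspace_single_0)
next
  case (Cons V Vs)
  then show ?case unfolding list_sums_Cons by (intro cvec.subspace_sums) auto
qed

lemma summand_subset_list_sums:
  "\<forall>V\<in>set Vs. cvec.subspace V \<Longrightarrow> W \<in> set Vs \<Longrightarrow> W \<subseteq> list_sums Vs"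
proof (induction Vs)
  case (Cons V Vs)
  have V0: "0 \<in> V" and L0: "0 \<in> list_sums Vs"
    using Cons.prems subspace_list_sums[of Vs] by (auto intro: cvec.subspace_0)
  show ?case
  proof
    fix w assume w: "w \<in> W"
    consider "w \<in> V" | "w \<in> list_sums Vs" using Cons w by auto
    then have "\<exists>x y. w = x + y \<and> x \<in> V \<and> y \<in> list_sums Vs"
    proof cases
      case 1 then show ?thesis using L0 by (intro exI[of _ w] exI[of _ 0]) simp
    next
      case 2 then show ?thesis using V0 by (intro exI[of _ 0] exI[of _ w]) simp
    qed
    then show "w \<in> list_sums (V # Vs)" unfolding list_sums_Cons by blast
  qed
qed simp

lemma list_sums_minimal:
  assumes "cvec.subspace S" "\<And>V. V \<in> set Vs \<Longrightarrow> V \<subseteq> S"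
  shows "list_sums Vs \<subseteq> S"
proof -
  have "sum_list vs \<in> S" if "list_all2 (\<in>) vs Vs" for vs
    using that assms(2)
    by (induction rule: list_all2_induct)
      (auto intro!: cvec.subspace_add[OF assms(1)] cvec.subspace_0[OF assms(1)])
  then show ?thesis unfolding list_sums_def by blast
qed

text \<open>A relation among the tail becomes one of the full list after a leading zero. Applied to
  the relabelled decomposition, this shows that the sums appearing as \<open>[H, H]\<close> are
  direct.\<close>

lemma is_direct_sum_tl: "is_direct_sum H (V # Vs) \<Longrightarrow> is_direct_sum (list_sums Vs) Vs"
proof -
  assume *: "is_direct_sum H (V # Vs)"
  have V0: "0 \<in> V" using * by (auto simp: is_direct_sum_iff intro: cvec.subspace_0)
  have "v = 0" if vs: "list_all2 (\<in>) vs Vs" "sum_list vs = 0" "v \<in> set vs" for vs v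
  proof -
    have "list_all2 (\<in>) (0 # vs) (V # Vs)" "sum_list (0 # vs) = 0" using vs V0 by auto
    then have "\<forall>v\<in>set (0 # vs). v = 0" using * unfolding is_direct_sum_iff by blast
    then show ?thesis using vs(3) by simp
  qed
  moreover have "\<forall>V\<in>set Vs. cvec.subspace V" using * by (simp add: is_direct_sum_iff)
  ultimately show ?thesis unfolding is_direct_sum_iff by blast
qed

lemma is_direct_sum_swap12:
  assumes "is_direct_sum H [A, B, C, D]"
  shows "is_direct_sum H [B, A, C, D]"
proof -
  have "list_sums [A, B, C, D] \<subseteq> list_sums [B, A, C, D]" for A B C D :: "'a set"
  proof
    fix u assume "u \<in> list_sums [A, B, C, D]"
    then obtain a b c d where *: "u = a + (b + (c + d))" "a \<in> A" "b \<in> B" "c \<in> C" "d \<in> D"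
      by (auto simp: list_sums_Cons)
    then have "u = b + (a + (c + d))" by (simp add: ac_simps)
    with * show "u \<in> list_sums [B, A, C, D]"
      unfolding list_sums_def by (intro CollectI exI[of _ "[b, a, c, d]"]) simp
  qed
  then have "list_sums [A, B, C, D] = list_sums [B, A, C, D]" by blast
  moreover have "\<forall>v\<in>set vs. v = 0" if vs: "list_all2 (\<in>) vs [B, A, C, D]" "sum_list vs = 0" for vs
  proof -
    obtain a b c d where *: "vs = [b, a, c, d]" "a \<in> A" "b \<in> B" "c \<in> C" "d \<in> D"
      using vs(1) by (auto simp: list_all2_Cons2)
    have "sum_list [a, b, c, d] = 0" using vs(2) * by (simp add: ac_simps)
    moreover have "list_all2 (\<in>) [a, b, c, d] [A, B, C, D]" using * by simp
    ultimately have "\<forall>v\<in>set [a, b, c, d]. v = 0" using assms unfolding is_direct_sum_iff by blast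
    then show ?thesis using * by auto
  qed
  ultimately show ?thesis using assms by (simp add: is_direct_sum_iff)
qed

lemma is_direct_sum_swap23:
  assumes "is_direct_sum H [A, B, C, D]"
  shows "is_direct_sum H [A, C, B, D]"
proof -
  have "list_sums [A, B, C, D] \<subseteq> list_sums [A, C, B, D]" for A B C D :: "'a set"
  proof
    fix u assume "u \<in> list_sums [A, B, C, D]"
    then obtain a b c d where *: "u = a + (b + (c + d))" "a \<in> A" "b \<in> B" "c \<in> C" "d \<in> D"
      by (auto simp: list_sums_Cons)
    then have "u = a + (c + (b + d))" by (simp add: ac_simps)
    with * show "u \<in> list_sums [A, C, B, D]"
      unfolding list_sums_def by (intro CollectI exI[of _ "[a, c, b, d]"]) simp
  qed
  then have "list_sums [A, B, C, D] = list_sums [A, C, B, D]" by blast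
  moreover have "\<forall>v\<in>set vs. v = 0" if vs: "list_all2 (\<in>) vs [A, C, B, D]" "sum_list vs = 0" for vs
  proof -
    obtain a b c d where *: "vs = [a, c, b, d]" "a \<in> A" "b \<in> B" "c \<in> C" "d \<in> D"
      using vs(1) by (auto simp: list_all2_Cons2)
    have "sum_list [a, b, c, d] = 0" using vs(2) * by (simp add: ac_simps)
    moreover have "list_all2 (\<in>) [a, b, c, d] [A, B, C, D]" using * by simp
    ultimately have "\<forall>v\<in>set [a, b, c, d]. v = 0" using assms unfolding is_direct_sum_iff by blast
    then show ?thesis using * by auto
  qed
  ultimately show ?thesis using assms by (simp add: is_direct_sum_iff)
qed

text \<open>Adjacent exchanges among the first three places reach all six orders; the last place,
  the center in the application, stays fixed.\<close>

lemma is_direct_sum_permute: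
  assumes "is_direct_sum H [X, Y, Z, D]" "{#A, B, C#} = {#X, Y, Z#}"
  shows "is_direct_sum H [A, B, C, D]"
proof -
  note s0 = assms(1)
  note s1 = is_direct_sum_swap12[OF s0]
  note s2 = is_direct_sum_swap23[OF s0]
  note s3 = is_direct_sum_swap23[OF s1]
  note s4 = is_direct_sum_swap12[OF s2]
  note s5 = is_direct_sum_swap12[OF s3]
  have "(A, B, C) \<in> {(X, Y, Z), (Y, X, Z), (X, Z, Y), (Y, Z, X), (Z, X, Y), (Z, Y, X)}"
    using assms(2) by (auto simp: add_eq_conv_ex)
  then show ?thesis using s0 s1 s2 s3 s4 s5 by auto
qed

text \<open>Bilinearity, used one argument at a time, gives one inclusion; for the other, each
  listed summand is attained by some pair.\<close>

lemma brackets_direct_sum: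
  fixes H :: "'g::complex_lie_algebra set"
  assumes H: "is_direct_sum H Vs" and sub: "\<forall>W\<in>set Ws. cvec.subspace W"
    and le: "\<And>X Y. X \<in> set Vs \<Longrightarrow> Y \<in> set Vs \<Longrightarrow> brackets X Y \<in> insert {0} (set Ws)"
    and ge: "\<And>W. W \<in> set Ws \<Longrightarrow> \<exists>X\<in>set Vs. \<exists>Y\<in>set Vs. brackets X Y = W"
  shows "brackets H H = list_sums Ws"
proof
  have sW: "cvec.subspace (list_sums Ws)" using sub by (rule subspace_list_sums)
  have subV: "\<forall>V\<in>set Vs. cvec.subspace V" and H_eq: "H = list_sums Vs"
    using H by (simp_all add: is_direct_sum_iff)
  have "lie x y \<in> list_sums Ws" if "X \<in> set Vs" "Y \<in> set Vs" "x \<in> X" "y \<in> Y" for x y X Y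
  proof -
    have "brackets X Y \<subseteq> list_sums Ws"
    proof (cases "brackets X Y = {0}")
      case True
      then show ?thesis using cvec.subspace_0[OF sW] by simp
    next
      case False
      then have "brackets X Y \<in> set Ws" using le[OF that(1,2)] by simp
      then show ?thesis by (rule summand_subset_list_sums[OF sub])
    qed
    then show ?thesis using lie_in_brackets[OF that(3,4)] by (rule subsetD)
  qed
  note gen = this
  have "list_sums Vs \<subseteq> {y. lie x y \<in> list_sums Ws}" if "X \<in> set Vs" "x \<in> X" for x X
    using gen[OF that(1) _ that(2)]
    by (intro list_sums_minimal) (auto intro!: cvec.subspaceI cvec.subspace_0[OF sW] cvec.subspace_add[OF sW]
        cvec.subspace_scale[OF sW] simp: lie_add_right lie_scaleC_right)
  note gen = this
  have "list_sums Vs \<subseteq> {x. lie x y \<in> list_sums Ws}" if "y \<in> list_sums Vs" for y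
    using gen that
    by (intro list_sums_minimal)
      (auto intro!: cvec.subspaceI cvec.subspace_0[OF sW] cvec.subspace_add[OF sW]
        cvec.subspace_scale[OF sW] simp: lie_add_left lie_scaleC_left)
  then show "brackets H H \<subseteq> list_sums Ws"
    unfolding H_eq by (intro brackets_minimal[OF sW]) blast
  show "list_sums Ws \<subseteq> brackets H H"
  proof (rule list_sums_minimal)
    fix W assume "W \<in> set Ws"
    then obtain X Y where XY: "X \<in> set Vs" "Y \<in> set Vs" "brackets X Y = W" using ge by blast
    have "X \<subseteq> H" "Y \<subseteq> H" unfolding H_eq
      using summand_subset_list_sums[OF subV] XY(1,2) by blast+
    then show "W \<subseteq> brackets H H" unfolding XY(3)[symmetric] by (rule brackets_mono)
  qed simp
qed

text \<open>Symmetry leaves one order of each pair. The pair \<open>{C, C}\<close> has no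
  alternative because every list in (2) and (3) omits it.\<close>

lemma unlisted_brackets_zeroI:
  assumes "\<And>X. X \<in> {A, B, C, D} \<Longrightarrow> brackets X D = {0}"
    "{A, A} \<in> P \<or> brackets A A = {0}" "{A, B} \<in> P \<or> brackets A B = {0}"
    "{B, B} \<in> P \<or> brackets B B = {0}" "{A, C} \<in> P \<or> brackets A C = {0}"
    "{B, C} \<in> P \<or> brackets B C = {0}" "brackets C C = {0}"
  shows "unlisted_brackets_zero {A, B, C, D} P"
  using assms brackets_commute[of B A] brackets_commute[of C A] brackets_commute[of C B]
    brackets_commute[of D] insert_commute[of B A] insert_commute[of C A] insert_commute[of C B]
  unfolding unlisted_brackets_zero_def by (elim disjE) simp_all

text \<open>Splitting both arguments along \<open>L + H\<close> shows that \<open>[g, g]\<close>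
  lies in \<open>L + [g, H]\<close>, since \<open>L\<close> is a subalgebra. By perfectness an
  element of \<open>H\<close> decomposes this way, and its part in \<open>L\<close> vanishes because
  \<open>L\<close> and \<open>H\<close> are independent.\<close>

lemma perfect_radical:
  fixes L H :: "'g::complex_lie_algebra set"
  assumes perf: "perfect_lie (UNIV :: 'g set)" and levi: "levi_decomposition L H"
  shows "lie_ideal H UNIV" "solvable_lie H" "H \<subseteq> brackets UNIV H"
proof -
  show H: "lie_ideal H UNIV" "solvable_lie H"
    using levi by (auto simp: levi_decomposition_def is_radical_def)
  have ds: "is_direct_sum UNIV [L, H]" and L: "lie_subalgebra L"
    using levi by (auto simp: levi_decomposition_def semisimple_lie_def)
  have sL: "cvec.subspace L" and sH: "cvec.subspace H"
    using L H by (auto simp: lie_subalgebra_def lie_ideal_def)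
  have dec: "\<exists>a b. x = a + b \<and> a \<in> L \<and> b \<in> H" for x
  proof -
    have "x \<in> list_sums [L, H]" using ds by (auto simp: is_direct_sum_iff)
    then show ?thesis by (simp add: list_sums_Cons)
  qed
  have indep: "a = 0" if "a \<in> L" "b \<in> H" "a + b = 0" for a b
  proof -
    have "list_all2 (\<in>) [a, b] [L, H]" "sum_list [a, b] = 0" using that by simp_all
    then have "\<forall>v\<in>set [a, b]. v = 0" using ds unfolding is_direct_sum_iff by blast
    then show ?thesis by simp
  qed
  let ?U = "{x + y | x y. x \<in> L \<and> y \<in> brackets UNIV H}"
  have sU: "cvec.subspace ?U" using sL by (intro cvec.subspace_sums) simp_all
  have "brackets UNIV UNIV \<subseteq> ?U"
  proof (rule brackets_minimal[OF sU])
    fix x y :: 'g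
    obtain a b where x: "x = a + b" "a \<in> L" "b \<in> H" using dec by blast
    obtain a' b' where y: "y = a' + b'" "a' \<in> L" "b' \<in> H" using dec by blast
    have "lie x y = lie a a' + (lie a b' + - lie y b)"
      using x(1) y(1) lie_swap[of b y] by (simp add: lie_add_left lie_add_right)
    moreover have "lie a a' \<in> L" using L x y by (simp add: lie_subalgebra_def)
    moreover have "lie a b' + - lie y b \<in> brackets UNIV H"
      using x y by (intro cvec.subspace_add cvec.subspace_neg) (auto intro: lie_in_brackets)
    ultimately show "lie x y \<in> ?U" by blast
  qed
  then have U: "?U = UNIV" using perf by (auto simp: perfect_lie_def)
  show "H \<subseteq> brackets UNIV H"
  proof
    fix z assume z: "z \<in> H"
    have "z \<in> ?U" unfolding U by simp
    then obtain x y where xy: "z = x + y" "x \<in> L" "y \<in> brackets UNIV H" by blast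
    have "brackets UNIV H \<subseteq> H"
      using H by (intro brackets_minimal) (auto simp: lie_ideal_def)
    then have "y - z \<in> H" using z xy(3) by (intro cvec.subspace_diff[OF sH]) blast+
    moreover have "x + (y - z) = 0" using xy(1) by simp
    ultimately have "x = 0" using indep xy(2) by blast
    then show "z \<in> brackets UNIV H" using xy by simp
  qed
qed

lemma summand_disjoint:
  assumes "is_direct_sum H Vs" "i < j" "j < length Vs"
  shows "Vs ! i \<inter> Vs ! j \<subseteq> {0}"
proof
  fix v assume v: "v \<in> Vs ! i \<inter> Vs ! j"
  have sub: "cvec.subspace (Vs ! k)" if "k < length Vs" for k
    using assms(1) that by (auto simp: is_direct_sum_iff)
  define w where "w k = (if k = i then v else if k = j then - v else 0)" for k
  let ?vs = "map w [0..<length Vs]"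
  have "list_all2 (\<in>) ?vs Vs"
    using v sub assms(3) by (auto simp: list_all2_conv_all_nth w_def cvec.subspace_neg cvec.subspace_0)
  moreover have "sum_list ?vs = 0"
  proof -
    have "sum_list ?vs = (\<Sum>k<length Vs. (if k = i then v else 0) + (if k = j then - v else 0))"
      using assms(2) by (simp add: interv_sum_list_conv_sum_set_nat atLeast0LessThan w_def)
        (intro sum.cong, auto)
    also have "\<dots> = 0" using assms(2,3) by (simp add: sum.distrib)
    finally show ?thesis .
  qed
  ultimately have "\<forall>u\<in>set ?vs. u = 0" using assms(1) unfolding is_direct_sum_iff by blast
  moreover have "v \<in> set ?vs" using assms(2,3) by (auto simp: w_def intro!: image_eqI[of _ _ i])
  ultimately show "v \<in> {0}" by blast
qed

lemma noncentral_summand: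
  fixes H :: "'g::complex_lie_algebra set"
  assumes ds: "is_direct_sum H Vs" and "X \<in> set Vs" "\<not> X \<subseteq> lie_center H"
  shows "\<exists>Y\<in>set Vs. brackets X Y \<noteq> {0}"
proof (rule ccontr)
  assume "\<not> (\<exists>Y\<in>set Vs. brackets X Y \<noteq> {0})"
  then have z: "lie x y = 0" if "Y \<in> set Vs" "x \<in> X" "y \<in> Y" for x y Y
    using that by (simp add: brackets_eq_0_iff)
  have H: "H = list_sums Vs" and sub: "\<forall>V\<in>set Vs. cvec.subspace V"
    using ds by (simp_all add: is_direct_sum_iff)
  have "list_sums Vs \<subseteq> {y. lie x y = 0}" if "x \<in> X" for x
    using z[OF _ that] by (intro list_sums_minimal)
      (auto intro!: cvec.subspaceI simp: lie_add_right lie_scaleC_right)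
  moreover have "X \<subseteq> H" unfolding H using summand_subset_list_sums[OF sub assms(2)] .
  ultimately have "X \<subseteq> lie_center H" unfolding H lie_center_def by blast
  then show False using assms(3) by blast
qed

section \<open>Multiplication tables of the summands\<close>

text \<open>The argument only uses which summand the bracket of two summands is: \<open>f\<close> is the bracket
  of subspaces, \<open>z\<close> the zero subspace, \<open>K\<close> the center \<open>V\<^sub>k\<close>, and \<open>d\<close> the depth of a
  subspace in the lower central series.\<close>

locale bracket_table =
  fixes f :: "'a \<Rightarrow> 'a \<Rightarrow> 'a" and z K A B C :: 'a and d :: "'a \<Rightarrow> nat"
  assumes distinct: "distinct [z, K, A, B, C]"
    and commute: "f X Y = f Y X"
    and central: "X \<in> {A, B, C} \<Longrightarrow> f X K = z" and zero: "f X z = z"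
    and closed: "X \<in> {A, B, C} \<Longrightarrow> Y \<in> {A, B, C} \<Longrightarrow> f X Y \<in> {z, K, A, B, C}"
    and rank: "X \<in> {A, B, C} \<Longrightarrow> Y \<in> {A, B, C} \<Longrightarrow> f X Y \<in> {A, B, C} \<Longrightarrow> d X < d (f X Y)"
    and jacobi: "f Y (f X Z) = z \<Longrightarrow> f Z (f X Y) = z \<Longrightarrow> f X (f Y Z) = z"
    and noncentral: "X \<in> {A, B, C} \<Longrightarrow> \<exists>Y\<in>{A, B, C}. f X Y \<noteq> z"
begin

text \<open>Apart from distinctness, the assumptions see \<open>A\<close>, \<open>B\<close>,
  \<open>C\<close> only through the set \<open>{A, B, C}\<close>, so a table may be reordered by
  depth.\<close>

lemma swap12: "bracket_table f z K B A C d"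
proof -
  have eq: "{B, A, C} = {A, B, C}" by auto
  show ?thesis
  proof (unfold_locales, unfold eq)
    show "distinct [z, K, B, A, C]" using distinct by auto
  qed (fact commute central zero closed rank jacobi noncentral)+
qed

lemma swap23: "bracket_table f z K A C B d"
proof -
  have eq: "{A, C, B} = {A, B, C}" by auto
  show ?thesis
  proof (unfold_locales, unfold eq)
    show "distinct [z, K, A, C, B]" using distinct by auto
  qed (fact commute central zero closed rank jacobi noncentral)+
qed

end

definition type1 :: "('a \<Rightarrow> 'a \<Rightarrow> 'a) \<Rightarrow> 'a \<Rightarrow> 'a \<Rightarrow> 'a \<Rightarrow> 'a \<Rightarrow> 'a \<Rightarrow> bool" where
  "type1 f z K A B C \<longleftrightarrow> (\<forall>X\<in>{A, B, C}. \<forall>Y\<in>{A, B, C}. f X Y \<in> {z, K})"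

definition type2 :: "('a \<Rightarrow> 'a \<Rightarrow> 'a) \<Rightarrow> 'a \<Rightarrow> 'a \<Rightarrow> 'a \<Rightarrow> 'a \<Rightarrow> 'a \<Rightarrow> bool" where
  "type2 f z K A B C \<longleftrightarrow> f A A = B \<and> f A B = C \<and> f A C = K \<and> f B B \<in> {K, z}
     \<and> f B C = z \<and> f C C = z"

text \<open>The disjuncts are (3a) to (3d) in this order; pairs that the theorem leaves unlisted
  appear as equations with \<open>z\<close>.\<close>

definition type3 :: "('a \<Rightarrow> 'a \<Rightarrow> 'a) \<Rightarrow> 'a \<Rightarrow> 'a \<Rightarrow> 'a \<Rightarrow> 'a \<Rightarrow> 'a \<Rightarrow> bool" where
  "type3 f z K A B C \<longleftrightarrow> f C C = z \<and> f A C = K \<and>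
    (f A A \<in> {C, K, z} \<and> f A B = C \<and> f B B \<in> {C, K, z} \<and> f B C = K
   \<or> f A A \<in> {C, K, z} \<and> f A B = C \<and> f B B \<in> {K, z} \<and> f B C = z
   \<or> f A A = C \<and> f A B = z \<and> f B B = K \<and> f B C = z
   \<or> f A A = C \<and> f A B = K \<and> f B B \<in> {K, z} \<and> f B C = z)"

context bracket_table
begin

text \<open>\<open>A\<close> and \<open>B\<close> are the generators, \<open>C\<close> a product of
  them. Whether \<open>f A B\<close> is \<open>C\<close> separates (3a), (3b) from (3c), (3d); the
  second alternative of the conclusion exchanges the generators.\<close>

lemma two_generators:
  assumes AA: "f A A \<in> {C, K, z}" and AB: "f A B \<in> {C, K, z}" and BB: "f B B \<in> {C, K, z}"
    and AC: "f A C \<in> {K, z}" and BC: "f B C \<in> {K, z}" and C: "C \<in> {f A A, f A B, f B B}"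
  shows "type3 f z K A B C \<or> type3 f z K B A C"
proof -
  have ne: "z \<noteq> K" "z \<noteq> C" "K \<noteq> C" "K \<noteq> z" "C \<noteq> z" "C \<noteq> K" using distinct by auto
  have AAC: "f X (f A C) = z" and BBC: "f X (f B C) = z" if "X \<in> {A, B, C}" for X
    using AC BC central[OF that] zero by auto
  obtain X Y where XY: "f X Y = C" "X \<in> {A, B}" "Y \<in> {A, B}" using C by auto
  \<comment> \<open>With one factor \<open>C\<close> written as \<open>f X Y\<close>, Jacobi reduces
    this to double products through \<open>f C A\<close> or \<open>f C B\<close>, which are central
    or zero.\<close>
  have CC: "f C C = z"
  proof -
    have "f V (f C W) = z" if "V \<in> {A, B}" "W \<in> {A, B}" for V W
      using that AAC[of V] BBC[of V] commute[of C W] by auto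
    then show ?thesis using jacobi[of X C Y] XY by simp
  qed
  have nonC: "f A C = K \<or> f B C = K"
    using noncentral[of C] CC AC BC commute[of C A] commute[of C B] by auto
  show ?thesis
  proof (cases "f A B = C")
    case True
    \<comment> \<open>Jacobi on \<open>A\<close>, \<open>B\<close>, \<open>B\<close> ties
      \<open>f A (f B B)\<close> to \<open>f B C\<close>; this removes \<open>C\<close> from the
      choices of \<open>f B B\<close> in (3b). The next claim is its mirror image.\<close>
    have "f B C = K" if "f B B = C" "f A C = K"
    proof (rule ccontr)
      assume "f B C \<noteq> K"
      then have "f B C = z" using BC by auto
      then have "f A (f B B) = z" using jacobi[of B A B] True by simp
      then show False using that ne by simp
    qed
    moreover have "f A C = K" if "f A A = C" "f B C = K"
    proof (rule ccontr)
      assume "f A C \<noteq> K"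
      then have "f A C = z" using AC by auto
      then have "f B (f A A) = z" using jacobi[of A B A] True commute[of A B] by simp
      then show False using that ne by simp
    qed
    ultimately show ?thesis
      using nonC True AA BB AC BC CC commute[of A B] unfolding type3_def by auto
  next
    case False
    then have AB': "f A B \<in> {K, z}" using AB by auto
    then have ABz: "f X (f A B) = z" if "X \<in> {A, B, C}" for X using central[OF that] zero by auto
    \<comment> \<open>As \<open>f A B\<close> is central or zero, Jacobi kills
      \<open>f B (f A A)\<close>, and likewise \<open>f A (f B B)\<close>. So at most one square is
      \<open>C\<close>, because \<open>C\<close> has a nonzero product with a generator.\<close>
    have 1: "f B C = z" if "f A A = C"
      using jacobi[of A B A] ABz commute[of A B] that by simp
    have 2: "f A C = z" if "f B B = C"
      using jacobi[of B A B] ABz that by simp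
    have nonA: "f A A \<noteq> z \<or> f A B \<noteq> z \<or> f A C \<noteq> z"
      and nonB: "f B B \<noteq> z \<or> f A B \<noteq> z \<or> f B C \<noteq> z"
      using noncentral[of A] noncentral[of B] commute[of A B] by auto
    have "f A A = C \<or> f B B = C" using C False by auto
    then show ?thesis
    proof
      assume "f A A = C"
      moreover from this have "f B C = z" "f A C = K" using 1 nonC ne by auto
      moreover from this have "f B B \<noteq> C" using 2 ne by auto
      ultimately show ?thesis
        using nonB AB' BB CC unfolding type3_def by auto
    next
      assume "f B B = C"
      moreover from this have "f A C = z" "f B C = K" using 2 nonC ne by auto
      moreover from this have "f A A \<noteq> C" using 1 ne by auto
      ultimately show ?thesis
        using nonA AB' AA CC commute[of A B] unfolding type3_def by auto
    qed
  qed
qed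

text \<open>After sorting by depth, products with \<open>C\<close> can only be \<open>K\<close> or
  \<open>z\<close>, those of \<open>A\<close> or \<open>B\<close> with \<open>B\<close> may also be
  \<open>C\<close>, and only \<open>f A A\<close> may be \<open>B\<close>. The four
  \<open>type3\<close> alternatives record whether \<open>C\<close> or \<open>B\<close> is the
  derived summand and which generator comes first.\<close>

lemma classification_ordered:
  assumes d: "d A \<le> d B" "d B \<le> d C"
  shows "type1 f z K A B C \<or> type2 f z K A B C
    \<or> type3 f z K A B C \<or> type3 f z K B A C \<or> type3 f z K A C B \<or> type3 f z K C A B"
proof -
  have ne: "z \<noteq> K" "z \<noteq> A" "z \<noteq> B" "z \<noteq> C" "K \<noteq> A" "K \<noteq> B" "K \<noteq> C" "A \<noteq> B" "A \<noteq> C" "B \<noteq> C"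
    using distinct by auto
  have C: "f X C \<in> {K, z}" if "X \<in> {A, B, C}" for X
    using closed[of C X] rank[of C X] commute[of X C] that d by fastforce
  have B: "f X B \<in> {C, K, z}" if "X \<in> {A, B}" for X
    using closed[of B X] rank[of B X] commute[of X B] that d by fastforce
  have A: "f A A \<in> {B, C, K, z}"
    using closed[of A A] rank[of A A] by fastforce
  have AC: "f A C \<in> {K, z}" and BC: "f B C \<in> {K, z}" and CC: "f C C \<in> {K, z}"
    and AB: "f A B \<in> {C, K, z}" and BB: "f B B \<in> {C, K, z}"
    using B C by auto
  show ?thesis
  proof (cases "f A A = B")
    case True
    show ?thesis
    proof (cases "f A B = C")
      case AB_C: True
      have AC0: "f X (f A C) = z" if "X \<in> {A, B, C}" for X using AC central[OF that] zero by auto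
      \<comment> \<open>Jacobi turns the chain \<open>B = f A A\<close>, \<open>C = f A B\<close>
        into \<open>f B C = z\<close> and then \<open>f C C = z\<close>, because double products
        through \<open>f A C\<close> vanish.\<close>
      then have BC0: "f B C = z"
        using AC0 jacobi[of A C A] True commute[of C A] commute[of C B] by simp
      then have CC0: "f C C = z"
        using jacobi[of A C B] AB_C commute[of C A] commute[of C B] zero
          AC0 by simp
      then have "f A C = K" using noncentral[of C] BC0 AC commute[of C A] commute[of C B] by auto
      moreover have "f B B \<noteq> C"
      proof
        assume BB_C: "f B B = C"
        have "f A (f B B) = z" using jacobi[of B A B] AB_C BC0 by simp
        then show False using BB_C \<open>f A C = K\<close> ne by simp
      qed
      ultimately show ?thesis
        using True AB_C BC0 CC0 BB unfolding type2_def by auto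
    next
      case AB_C: False
      then have AB': "f A B \<in> {K, z}" using AB by auto
      then have "f X (f A B) = z" if "X \<in> {A, B, C}" for X using central[OF that] zero by auto
      then have "f B (f A A) = z" using jacobi[of A B A] commute[of A B] by simp
      then have BB': "f B B = z" using True by simp
      \<comment> \<open>Now \<open>B\<close> is the derived summand, and \<open>C\<close>, though
        deepest, takes over as the second generator.\<close>
      interpret s: bracket_table f z K A C B d by (rule swap23)
      have "type3 f z K A C B \<or> type3 f z K C A B"
        by (rule s.two_generators)
          (use True AC CC AB' BC commute[of C B] in auto)
      then show ?thesis by blast
    qed
  next
    case False
    then have AA: "f A A \<in> {C, K, z}" using A by auto
    show ?thesis
    proof (cases "C \<in> {f A A, f A B, f B B}")
      case True
      then show ?thesis using two_generators[OF AA AB BB AC BC] by blast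
    next
      case no_C: False
      then have "type1 f z K A B C"
        using AA AB BB AC BC CC commute[of B A] commute[of C A] commute[of C B]
        unfolding type1_def by auto
      then show ?thesis by blast
    qed
  qed
qed

theorem classification:
  "\<exists>A' B' C'. {#A', B', C'#} = {#A, B, C#} \<and>
    (type1 f z K A' B' C' \<or> type2 f z K A' B' C' \<or> type3 f z K A' B' C')"
proof -
  have sorted: ?thesis
    if T: "bracket_table f z K X Y Z d" and le: "d X \<le> d Y" "d Y \<le> d Z"
      and eq: "{#X, Y, Z#} = {#A, B, C#}" for X Y Z
  proof -
    have "{#Y, X, Z#} = {#A, B, C#}" "{#X, Z, Y#} = {#A, B, C#}" "{#Z, X, Y#} = {#A, B, C#}"
      unfolding eq[symmetric] by (simp_all add: add_mset_commute)
    then show ?thesis using bracket_table.classification_ordered[OF T le] eq by metis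
  qed
  have T1: "bracket_table f z K A B C d" by unfold_locales
  note T2 = bracket_table.swap12[OF T1]
  note T3 = bracket_table.swap23[OF T1]
  note T4 = bracket_table.swap23[OF T2]
  note T5 = bracket_table.swap12[OF T3]
  note T6 = bracket_table.swap12[OF T4]
  have eqs: "{#B, A, C#} = {#A, B, C#}" "{#A, C, B#} = {#A, B, C#}" "{#B, C, A#} = {#A, B, C#}"
    "{#C, A, B#} = {#A, B, C#}" "{#C, B, A#} = {#A, B, C#}"
    by (simp_all add: add_mset_commute)
  consider "d A \<le> d B" "d B \<le> d C" | "d B \<le> d A" "d A \<le> d C" | "d A \<le> d C" "d C \<le> d B"
    | "d B \<le> d C" "d C \<le> d A" | "d C \<le> d A" "d A \<le> d B" | "d C \<le> d B" "d B \<le> d A"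
    by linarith
  then show ?thesis
  proof cases
    case 1 then show ?thesis by (rule sorted[OF T1]) simp
  next
    case 2 then show ?thesis by (rule sorted[OF T2]) (rule eqs)
  next
    case 3 then show ?thesis by (rule sorted[OF T3]) (rule eqs)
  next
    case 4 then show ?thesis by (rule sorted[OF T4]) (rule eqs)
  next
    case 5 then show ?thesis by (rule sorted[OF T5]) (rule eqs)
  next
    case 6 then show ?thesis by (rule sorted[OF T6]) (rule eqs)
  qed
qed

end

section \<open>Translation between subspaces and tables\<close>

theorem theorem3p14:
  fixes L H Vn Vm Vp Vk :: "'g::complex_lie_algebra set"
  assumes "perfect_lie (UNIV :: 'g set)"
    and "levi_decomposition L H"
    and "simple_lie L"
    and "\<forall>V\<in>{Vn, Vm, Vp, Vk}. simple_submodule L V"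
    and "is_direct_sum H [Vn, Vm, Vp, Vk]"
    and "lie_center H = Vk"
    and "\<forall>V\<in>{Vn, Vm, Vp, Vk}. \<forall>W\<in>{Vn, Vm, Vp, Vk}.
           brackets V W \<noteq> {0} \<longrightarrow> (\<exists>!U. U \<in> {Vn, Vm, Vp, Vk} \<and> brackets V W = U)"
  shows "\<exists>A B C. {#A, B, C#} = {#Vn, Vm, Vp#} \<and>
    (brackets H H = lie_center H
     \<or> (is_direct_sum (brackets H H) [B, C, Vk] \<and>
        brackets A A = B \<and> brackets A B = C \<and> brackets A C = Vk \<and>
        brackets B B \<in> {Vk, {0}} \<and>
        unlisted_brackets_zero {A, B, C, Vk} {{A, A}, {A, B}, {A, C}, {B, B}})
     \<or> (is_direct_sum (brackets H H) [C, Vk] \<and>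
        ((brackets A A \<in> {C, Vk, {0}} \<and> brackets A B = C \<and> brackets B B \<in> {C, Vk, {0}} \<and>
          brackets A C = Vk \<and> brackets B C = Vk \<and>
          unlisted_brackets_zero {A, B, C, Vk} {{A, A}, {A, B}, {B, B}, {A, C}, {B, C}})
         \<or> (brackets A A \<in> {C, Vk, {0}} \<and> brackets A B = C \<and> brackets B B \<in> {Vk, {0}} \<and>
            brackets A C = Vk \<and>
            unlisted_brackets_zero {A, B, C, Vk} {{A, A}, {A, B}, {B, B}, {A, C}})
         \<or> (brackets A A = C \<and> brackets B B = Vk \<and> brackets A C = Vk \<and>
            unlisted_brackets_zero {A, B, C, Vk} {{A, A}, {B, B}, {A, C}})
         \<or> (brackets A A = C \<and> brackets A B = Vk \<and> brackets B B \<in> {Vk, {0}} \<and>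
            brackets A C = Vk \<and>
            unlisted_brackets_zero {A, B, C, Vk} {{A, A}, {A, B}, {B, B}, {A, C}}))))"
proof -
  let ?S = "{Vn, Vm, Vp, Vk}"
  have H: "lie_ideal H UNIV" "solvable_lie H" "H \<subseteq> brackets UNIV H"
    using perfect_radical[OF assms(1,2)] by blast+
  obtain n where "lower_central_series n H = {0}" using radical_nilpotent[OF H] by blast
  from lower_central_rank[OF this] obtain d :: "'g set \<Rightarrow> nat" where
    d: "\<And>X Y. X \<subseteq> H \<Longrightarrow> Y \<subseteq> H \<Longrightarrow> brackets X Y \<subseteq> H \<Longrightarrow> brackets X Y \<noteq> {0} \<Longrightarrow> d X < d (brackets X Y)"
    by blast
  note ds = assms(5)
  have sub: "\<forall>V\<in>set [Vn, Vm, Vp, Vk]. cvec.subspace V" and H_eq: "H = list_sums [Vn, Vm, Vp, Vk]"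
    using ds unfolding is_direct_sum_iff by blast+
  have SH: "X \<subseteq> H" if "X \<in> ?S" for X
    unfolding H_eq using that by (intro summand_subset_list_sums[OF sub]) simp
  have nz: "X \<noteq> {0}" if "X \<in> ?S" for X using bspec[OF assms(4) that] by (simp add: simple_submodule_def)
  have zero_mem: "0 \<in> X" if "X \<in> ?S" for X using that by (intro cvec.subspace_0 bspec[OF sub]) simp
  have disj: "[Vn, Vm, Vp, Vk] ! i \<inter> [Vn, Vm, Vp, Vk] ! j \<subseteq> {0}" if "i < j" "j < 4" for i j
    using summand_disjoint[OF ds that(1)] that(2) by simp
  have dk: "Vn \<inter> Vk \<subseteq> {0}" "Vm \<inter> Vk \<subseteq> {0}" "Vp \<inter> Vk \<subseteq> {0}"
    and d3: "Vn \<inter> Vm \<subseteq> {0}" "Vn \<inter> Vp \<subseteq> {0}" "Vm \<inter> Vp \<subseteq> {0}"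
    using disj[of 0 3] disj[of 1 3] disj[of 2 3] disj[of 0 1] disj[of 0 2] disj[of 1 2] by simp_all
  \<comment> \<open>Isomorphic summands are still different subspaces, as nonzero subspaces meeting
    only in zero; so the value of a bracket names at most one summand.\<close>
  have neq: "X \<noteq> Y" if "X \<in> ?S" "X \<inter> Y \<subseteq> {0}" for X Y
    using nz[OF that(1)] zero_mem[OF that(1)] that(2) by blast
  have central: "brackets X Vk = {0}" if "X \<in> ?S" for X
  proof -
    have "lie v x = 0" if "v \<in> Vk" "x \<in> X" for v x
      using that SH[OF \<open>X \<in> ?S\<close>] assms(6) by (auto simp: lie_center_def)
    then have "brackets Vk X = {0}" by (simp add: brackets_eq_0_iff)
    then show ?thesis by (simp add: brackets_commute)
  qed
  have closed: "brackets X Y \<in> insert {0} ?S" if "X \<in> ?S" "Y \<in> ?S" for X Y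
  proof (cases "brackets X Y = {0}")
    case False
    with bspec[OF bspec[OF assms(7) that(1)] that(2)]
    obtain U where "U \<in> ?S" "brackets X Y = U" by (elim impE ex1E conjE)
    then show ?thesis by simp
  qed simp
  have ext: "X \<in> ?S" if "X \<in> {Vn, Vm, Vp}" for X using that by auto
  interpret T: bracket_table brackets "{0}" Vk Vn Vm Vp d
  proof
    show "distinct [{0}, Vk, Vn, Vm, Vp]"
      using neq[OF _ dk(1)] neq[OF _ dk(2)] neq[OF _ dk(3)] neq[OF _ d3(1)] neq[OF _ d3(2)]
        neq[OF _ d3(3)] nz[of Vn] nz[of Vm] nz[of Vp] nz[of Vk] by (simp add: eq_commute)
    show "brackets X Y = brackets Y X" for X Y :: "'g set" by (rule brackets_commute)
    show "brackets X {0} = {0}" for X :: "'g set" by (simp add: brackets_eq_0_iff)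
    show "brackets X Vk = {0}" if "X \<in> {Vn, Vm, Vp}" for X by (rule central[OF ext[OF that]])
    show "brackets X Y \<in> {{0}, Vk, Vn, Vm, Vp}" if "X \<in> {Vn, Vm, Vp}" "Y \<in> {Vn, Vm, Vp}" for X Y
      using closed[OF ext[OF that(1)] ext[OF that(2)]] by auto
    show "d X < d (brackets X Y)"
      if "X \<in> {Vn, Vm, Vp}" "Y \<in> {Vn, Vm, Vp}" "brackets X Y \<in> {Vn, Vm, Vp}" for X Y
      using that[THEN ext] by (intro d SH nz)
    show "brackets X (brackets Y Z) = {0}"
      if "brackets Y (brackets X Z) = {0}" "brackets Z (brackets X Y) = {0}" for X Y Z :: "'g set"
      using that by (rule brackets_jacobi)
    \<comment> \<open>A nonzero summand meeting the center \<open>Vk\<close> only in zero is not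
      central; a partner with nonzero bracket cannot be \<open>Vk\<close>, hence is one of the
      three.\<close>
    show "\<exists>Y\<in>{Vn, Vm, Vp}. brackets X Y \<noteq> {0}" if X: "X \<in> {Vn, Vm, Vp}" for X
    proof -
      have "X \<inter> Vk \<subseteq> {0}" using X dk by (elim insertE) simp_all
      moreover have "X \<noteq> {0}" "0 \<in> X" by (rule nz[OF ext[OF X]], rule zero_mem[OF ext[OF X]])
      ultimately have "\<not> X \<subseteq> lie_center H" unfolding assms(6) by blast
      then have "\<exists>Y\<in>set [Vn, Vm, Vp, Vk]. brackets X Y \<noteq> {0}"
        using X by (intro noncentral_summand[OF ds]) auto
      then show ?thesis using central[OF ext[OF X]] by auto
    qed
  qed
  obtain A B C where ABC: "{#A, B, C#} = {#Vn, Vm, Vp#}"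
    and types: "type1 brackets {0} Vk A B C \<or> type2 brackets {0} Vk A B C \<or> type3 brackets {0} Vk A B C"
    using T.classification by blast
  have "set_mset {#A, B, C#} = set_mset {#Vn, Vm, Vp#}" unfolding ABC ..
  then have S_eq: "{A, B, C} = {Vn, Vm, Vp}" by simp
  then have S4: "{A, B, C, Vk} = ?S" by blast
  have ds': "is_direct_sum H [A, B, C, Vk]" using ds ABC by (rule is_direct_sum_permute)
  note ds3 = is_direct_sum_tl[OF ds']
  note ds2 = is_direct_sum_tl[OF ds3]
  have Vk: "brackets X Vk = {0}" "brackets Vk X = {0}" if "X \<in> {A, B, C, Vk}" for X
    using central that brackets_commute[of Vk X] unfolding S4 by metis+
  have comm: "brackets B A = brackets A B" "brackets C A = brackets A C" "brackets C B = brackets B C"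
    by (rule brackets_commute)+
  have C_nz: "\<exists>Y\<in>{A, B, C}. brackets C Y \<noteq> {0}" using T.noncentral[of C] unfolding S_eq[symmetric] by simp
  have HH: "brackets H H = list_sums Ws"
    if "\<forall>W\<in>set Ws. cvec.subspace W"
      "\<forall>X\<in>{A, B, C}. \<forall>Y\<in>{A, B, C}. brackets X Y \<in> insert {0} (set Ws)"
      "\<forall>W\<in>set Ws. \<exists>X\<in>{A, B, C}. \<exists>Y\<in>{A, B, C}. brackets X Y = W" for Ws
  proof (rule brackets_direct_sum[OF ds' that(1)])
    fix X Y assume XY: "X \<in> set [A, B, C, Vk]" "Y \<in> set [A, B, C, Vk]"
    show "brackets X Y \<in> insert {0} (set Ws)"
    proof (cases "X = Vk \<or> Y = Vk")
      case True
      then have "brackets X Y = {0}" using Vk(1)[of X] Vk(2)[of Y] XY by auto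
      then show ?thesis by simp
    next
      case False
      then have "X \<in> {A, B, C}" "Y \<in> {A, B, C}" using XY by auto
      then show ?thesis using that(2) by blast
    qed
  next
    fix W assume "W \<in> set Ws"
    with that(3) obtain X Y where "X \<in> {A, B, C}" "Y \<in> {A, B, C}" "brackets X Y = W" by meson
    then show "\<exists>X\<in>set [A, B, C, Vk]. \<exists>Y\<in>set [A, B, C, Vk]. brackets X Y = W"
      by (intro bexI[of _ X] bexI[of _ Y]) auto
  qed
  have subs: "cvec.subspace B" "cvec.subspace C" "cvec.subspace Vk"
    using ds' by (simp_all add: is_direct_sum_iff)
  from types show ?thesis
  proof (elim disjE)
    assume t: "type1 brackets {0} Vk A B C"
    have cl: "brackets X Y \<in> {{0}, Vk}" if "X \<in> {A, B, C}" "Y \<in> {A, B, C}" for X Y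
      by (rule bspec[OF bspec[OF t[unfolded type1_def] that(1)] that(2)])
    obtain Y where Y: "Y \<in> {A, B, C}" "brackets C Y \<noteq> {0}" using C_nz by (elim bexE)
    \<comment> \<open>Noncentrality of \<open>C\<close> supplies a nonzero product, so
      \<open>[H, H]\<close> is all of \<open>Vk\<close> and not zero.\<close>
    have "brackets C Y = Vk" using cl[OF _ Y(1), of C] Y(2) by simp
    then have "\<exists>X\<in>{A, B, C}. \<exists>Y\<in>{A, B, C}. brackets X Y = Vk"
      using Y(1) by (intro bexI[of _ C] bexI[of _ Y]) simp_all
    then have "brackets H H = list_sums [Vk]" using cl subs by (intro HH) simp_all
    then have "brackets H H = lie_center H" unfolding assms(6) by (simp add: list_sums_Cons)
    then show ?thesis
      by - (rule exI[of _ A], rule exI[of _ B], rule exI[of _ C], rule conjI[OF ABC], simp)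
  next
    assume t: "type2 brackets {0} Vk A B C"
    have "brackets H H = list_sums [B, C, Vk]"
      using t subs comm unfolding type2_def by (intro HH) (simp_all, auto)
    then have "is_direct_sum (brackets H H) [B, C, Vk]" using ds3 by simp
    moreover have "unlisted_brackets_zero {A, B, C, Vk} {{A, A}, {A, B}, {A, C}, {B, B}}"
      using t Vk by (intro unlisted_brackets_zeroI) (auto simp: type2_def)
    ultimately show ?thesis
      using t unfolding type2_def
      by - (rule exI[of _ A], rule exI[of _ B], rule exI[of _ C], rule conjI[OF ABC], simp)
  next
    assume t: "type3 brackets {0} Vk A B C"
    have "brackets H H = list_sums [C, Vk]"
      using t subs comm unfolding type3_def by (intro HH) (simp_all, auto)
    then have ds: "is_direct_sum (brackets H H) [C, Vk]" using ds2 by simp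
    have U: "unlisted_brackets_zero {A, B, C, Vk} P"
      if "{A, A} \<in> P \<or> brackets A A = {0}" "{A, B} \<in> P \<or> brackets A B = {0}"
        "{B, B} \<in> P \<or> brackets B B = {0}" "{A, C} \<in> P" "{B, C} \<in> P \<or> brackets B C = {0}" for P
      using t Vk that by (intro unlisted_brackets_zeroI) (auto simp: type3_def)
    show ?thesis
      using t[unfolded type3_def] ds
      by - (rule exI[of _ A], rule exI[of _ B], rule exI[of _ C], rule conjI[OF ABC],
          elim conjE disjE, simp_all add: U)
  qed
qed

end
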